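(* Fix $P_{\mathrm t}>0$ and consider the semi-infinite max-min fairness problem (SI), its sampled versions (S$_i$), and the cutting-set algorithm, all defined in the context. Given that the optimization step of the algorithm yields a KKT point of the corresponding sampled problem (S$_i$), and that the pessimization step is exact (i.e. global minimizers of the worst-case channel problems are obtained), the iterates generated by the algorithm converge to the set of KKT points of the semi-infinite problem (SI).
   Context: Setting. $K\le N_t$, $\mathcal K=\{1,\dots,K\}$, $\sigma_{\mathrm n}^2>0$. $\mathbf P=[\mathbf p_{\mathrm c},\mathbf p_1,\dots,\mathbf p_K]\in\mathbb C^{N_t\times(K+1)}$. For $\mathbf h\in\mathbb C^{N_t}$ the common and private rates of user $k$ are $$R_{\mathrm c,k}(\mathbf h)=\log_2\Big(1+\frac{|\mathbf h^H\mathbf p_{\mathrm c}|^2}{\sum_{i=1}^K|\mathbf h^H\mathbf p_i|^2+\sigma_{\mathrm n}^2}\Big),\qquad R_k(\mathbf h)=\log_2\Big(1+\frac{|\mathbf h^H\mathbf p_k|^2}{\sum_{i\ne k}|\mathbf h^H\mathbf p_i|^2+\sigma_{\mathrm n}^2}\Big).$$ Given $\widehat{\mathbf h}_k\in\mathbb C^{N_t}$ and $\delta_k\ge0$, $\mathbb H_k=\{\mathbf h:\|\mathbf h-\widehat{\mathbf h}_k\|\le\delta_k\}$. (SI): maximize $\bar R_{\mathrm t}$ over $\bar R_{\mathrm t}$, $\bar{\mathbf c}=(\bar C_1,\dots,\bar C_K)$ and $\mathbf P$, subject to: $R_k(\mathbf h)+\bar C_k\ge\bar R_{\mathrm t}$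 for all $\mathbf h\in\mathbb H_k$, $k\in\mathcal K$; $R_{\mathrm c,k}(\mathbf h)\ge\sum_{l=1}^K\bar C_l$ for all $\mathbf h\in\mathbb H_k$, $k\in\mathcal K$; $\bar C_k\ge0$ for all $k\in\mathcal K$; $\mathrm{tr}(\mathbf P\mathbf P^H)\le P_{\mathrm t}$. (S$_i$): the same problem in which, for each $k$, the private-rate constraints are imposed only for $\mathbf h$ in a finite set $\overline{\mathbb H}_k\subset\mathbb H_k$ and the common-rate constraints only for $\mathbf h$ in a finite set $\overline{\mathbb H}_{\mathrm c,k}\subset\mathbb H_k$ (the current sets at iteration $i$). Cutting-set algorithm. Initialize $\overline{\mathbb H}_k=\overline{\mathbb H}_{\mathrm c,k}=\{\widehat{\mathbf h}_k\}$ for all $k$. At iteration $i=1,2,\dots$: (Optimization) solve (S$_i$), obtaining a point $(\bar R_{\mathrm t}^{(i)},\bar{\mathbf c}^{(i)},\mathbf P^{(i)})$. (Pessimization) writing $R_k^{(i)},R_{\mathrm c,k}^{(i)}$ for the rates when $\mathbf P^{(i)}$ is employed, compute for each $k$ worst-case channels $\mathbf h_k^\ast=\arg\min_{\mathbf h\in\mathbb H_k}R_k^{(i)}(\mathbf h)$ and $\mathbf h_{\mathrm c,k}^\ast=\arg\min_{\mathbf h\in\mathbb H_k}R_{\mathrm c,k}^{(i)}(\mathbf h)$; if $R_k^{(i)}(\mathbf h_k^\ast)+\bar C_k^{(i)}<\bar R_{\mathrm t}^{(i)}$, append $\mathbf h_k^\ast$ to $\overline{\mathbb H}_k$; if $R_{\mathrm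 c,k}^{(i)}(\mathbf h_{\mathrm c,k}^\ast)<\sum_{l=1}^K\bar C_l^{(i)}$, append $\mathbf h_{\mathrm c,k}^\ast$ to $\overline{\mathbb H}_{\mathrm c,k}$. The iterates are the points $(\bar R_{\mathrm t}^{(i)},\bar{\mathbf c}^{(i)},\mathbf P^{(i)})$; convergence refers to $i\to\infty$. KKT points. Write a problem as $\min_{\mathbf x}f_0(\mathbf x)$ s.t. $f_m(\mathbf x,t)\le0$ for all $t\in\mathcal T_m$, $m=1,\dots,M$, with $\mathcal T_m$ compact (finite in the case of (S$_i$)). A point $\bar{\mathbf x}$ is a KKT point if it is feasible and there are nonnegative measures $\bar\mu_m$ on $\mathcal T_m$ (ordinary nonnegative multipliers when $\mathcal T_m$ is finite) with $\nabla f_0(\bar{\mathbf x})+\sum_m\int_{\mathcal T_m}\nabla_{\mathbf x}f_m(\bar{\mathbf x},t)\,\mathrm d\bar\mu_m(t)=\mathbf 0$ and $\int_{\mathcal T_m}f_m(\bar{\mathbf x},t)\,\mathrm d\bar\mu_m(t)=0$ for all $m$. *)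

theory Defs
  imports "HOL-Analysis.Analysis"
begin

section \<open>KKT points\<close>

text \<open>The gradient with respect to the real inner product; a complex variable is thus treated
  as the pair of its real and imaginary parts.\<close>

definition gradient :: "('a::euclidean_space \<Rightarrow> real) \<Rightarrow> 'a \<Rightarrow> 'a" where
  "gradient f x = (THE D. GDERIV f x :> D)"

lemma gradient_eqI:
  assumes "GDERIV f x :> D"
  shows "gradient f x = D"
  unfolding gradient_def
proof (rule the_equality[where P = "\<lambda>D. GDERIV f x :> D", OF assms])
  fix D' assume "GDERIV f x :> D'"
  with assms have "(\<lambda>h. inner h D') = (\<lambda>h. inner h D)"
    unfolding gderiv_def by (rule has_derivative_unique[rotated])
  then have "inner h D' = inner h D" for h
    by (rule fun_cong)
  then show "D' = D"
    using vector_eq_ldot[of D' D] by blast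
qed

text \<open>A problem minimizes \<open>f0 x\<close> subject to \<open>f m x t \<le> 0\<close> for all \<open>m\<close> and all \<open>t \<in> T m\<close>.\<close>

definition feasible :: "('m \<Rightarrow> 'x \<Rightarrow> 't \<Rightarrow> real) \<Rightarrow> ('m \<Rightarrow> 't set) \<Rightarrow> 'x \<Rightarrow> bool" where
  "feasible f T x \<longleftrightarrow> (\<forall>m. \<forall>t\<in>T m. f m x t \<le> 0)"

text \<open>Multipliers are finite nonnegative Borel measures on the index sets.\<close>

definition kkt_point ::
  "('x::euclidean_space \<Rightarrow> real) \<Rightarrow> ('m::finite \<Rightarrow> 'x \<Rightarrow> 't::topological_space \<Rightarrow> real) \<Rightarrow>
   ('m \<Rightarrow> 't set) \<Rightarrow> 'x \<Rightarrow> bool" where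
  "kkt_point f0 f T x \<longleftrightarrow> feasible f T x \<and>
    (\<exists>\<mu> :: 'm \<Rightarrow> 't measure.
      (\<forall>m. finite_measure (\<mu> m) \<and> sets (\<mu> m) = sets (restrict_space borel (T m))) \<and>
      gradient f0 x + (\<Sum>m\<in>UNIV. \<integral>t. gradient (\<lambda>y. f m y t) x \<partial>\<mu> m) = 0 \<and>
      (\<forall>m. (\<integral>t. f m x t \<partial>\<mu> m) = 0))"

text \<open>Ordinary multipliers, for finite index sets.\<close>

definition kkt_point_finite ::
  "('x::euclidean_space \<Rightarrow> real) \<Rightarrow> ('m::finite \<Rightarrow> 'x \<Rightarrow> 't \<Rightarrow> real) \<Rightarrow>
   ('m \<Rightarrow> 't set) \<Rightarrow> 'x \<Rightarrow> bool" where
  "kkt_point_finite f0 f T x \<longleftrightarrow> (\<forall>m. finite (T m)) \<and> feasible f T x \<and>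
    (\<exists>\<mu> :: 'm \<Rightarrow> 't \<Rightarrow> real.
      (\<forall>m. \<forall>t\<in>T m. \<mu> m t \<ge> 0) \<and>
      gradient f0 x + (\<Sum>m\<in>UNIV. \<Sum>t\<in>T m. \<mu> m t *\<^sub>R gradient (\<lambda>y. f m y t) x) = 0 \<and>
      (\<forall>m. (\<Sum>t\<in>T m. \<mu> m t * f m x t) = 0))"


section \<open>Rates\<close>

text \<open>\<open>'n\<close> indexes the \<open>N\<^sub>t\<close> antennas and \<open>'k\<close> the \<open>K\<close> users. The columns of a precoder are indexed
  by \<open>'k option\<close>: \<open>None\<close> is the common stream and \<open>Some k\<close> the private stream of user \<open>k\<close>.\<close>

type_synonym ('n, 'k) precoder = "((complex, 'k option) vec, 'n) vec"

definition herm_inner :: "complex^'n \<Rightarrow> complex^'n \<Rightarrow> complex" where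
  "herm_inner h p = (\<Sum>j\<in>UNIV. cnj (h $ j) * p $ j)"

definition conj_transpose :: "complex^'m^'n \<Rightarrow> complex^'n^'m" where
  "conj_transpose A = (\<chi> i j. cnj (A $ j $ i))"

definition common_rate :: "real \<Rightarrow> ('n::finite, 'k::finite) precoder \<Rightarrow> complex^'n \<Rightarrow> real" where
  "common_rate \<sigma> P h = log 2 (1 +
     (cmod (herm_inner h (column None P)))\<^sup>2 /
     ((\<Sum>i\<in>UNIV. (cmod (herm_inner h (column (Some i) P)))\<^sup>2) + \<sigma>\<^sup>2))"

definition private_rate ::
  "real \<Rightarrow> ('n::finite, 'k::finite) precoder \<Rightarrow> 'k \<Rightarrow> complex^'n \<Rightarrow> real" where
  "private_rate \<sigma> P k h = log 2 (1 +
     (cmod (herm_inner h (column (Some k) P)))\<^sup>2 /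
     ((\<Sum>i\<in>UNIV - {k}. (cmod (herm_inner h (column (Some i) P)))\<^sup>2) + \<sigma>\<^sup>2))"

definition uncertainty_set ::
  "('k \<Rightarrow> complex^'n) \<Rightarrow> ('k \<Rightarrow> real) \<Rightarrow> 'k \<Rightarrow> (complex^'n) set" where
  "uncertainty_set hhat \<delta> k = {h. norm (h - hhat k) \<le> \<delta> k}"


section \<open>The semi-infinite problem and its sampled versions\<close>

text \<open>The optimization variable \<open>(R\<^sub>t, c, P)\<close>.\<close>

type_synonym ('n, 'k) point = "real \<times> (real, 'k) vec \<times> ('n, 'k) precoder"

definition Rt_of :: "('n::finite, 'k::finite) point \<Rightarrow> real" where
  "Rt_of x = fst x"

definition C_of :: "('n::finite, 'k::finite) point \<Rightarrow> real^'k" where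
  "C_of x = fst (snd x)"

definition P_of :: "('n::finite, 'k::finite) point \<Rightarrow> ('n, 'k) precoder" where
  "P_of x = snd (snd x)"

datatype 'k constr = Private 'k | Common 'k | Nonneg 'k | Power

instance constr :: (finite) finite
proof
  have "(UNIV :: 'a constr set) = range Private \<union> range Common \<union> range Nonneg \<union> {Power}"
  proof (rule UNIV_eq_I)
    fix c :: "'a constr"
    show "c \<in> range Private \<union> range Common \<union> range Nonneg \<union> {Power}"
      by (cases c) simp_all
  qed
  moreover have "finite (range Private \<union> range Common \<union> range Nonneg \<union> {Power :: 'a constr})"
    by simp
  ultimately show "finite (UNIV :: 'a constr set)"
    by (rule ssubst)
qed

definition objective :: "('n::finite, 'k::finite) point \<Rightarrow> real" where
  "objective x = - Rt_of x"

fun constraint :: "real \<Rightarrow> real \<Rightarrow> 'k constr \<Rightarrow> ('n::finite, 'k::finite) point \<Rightarrow> complex^'n \<Rightarrow> real"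
  where
  "constraint \<sigma> Pt (Private k) x h = Rt_of x - (private_rate \<sigma> (P_of x) k h + C_of x $ k)"
| "constraint \<sigma> Pt (Common k) x h = (\<Sum>l\<in>UNIV. C_of x $ l) - common_rate \<sigma> (P_of x) h"
| "constraint \<sigma> Pt (Nonneg k) x h = - (C_of x $ k)"
| "constraint \<sigma> Pt Power x h = Re (trace (P_of x ** conj_transpose (P_of x))) - Pt"

text \<open>\<open>H\<close> and \<open>Hc\<close> hold the channels at which the private and the common rate constraints are
  imposed. The constraints \<open>Nonneg\<close> and \<open>Power\<close> do not depend on the channel; they get a one-point
  index set, so that their multiplier is a single nonnegative number.\<close>

fun index_sets ::
  "('k \<Rightarrow> (complex^'n) set) \<Rightarrow> ('k \<Rightarrow> (complex^'n) set) \<Rightarrow> 'k constr \<Rightarrow> (complex^'n) set" where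
  "index_sets H Hc (Private k) = H k"
| "index_sets H Hc (Common k) = Hc k"
| "index_sets H Hc (Nonneg k) = {0}"
| "index_sets H Hc Power = {0}"

definition SI_kkt_point ::
  "real \<Rightarrow> real \<Rightarrow> ('k \<Rightarrow> complex^'n) \<Rightarrow> ('k \<Rightarrow> real) \<Rightarrow> ('n::finite, 'k::finite) point \<Rightarrow> bool" where
  "SI_kkt_point \<sigma> Pt hhat \<delta> x \<longleftrightarrow>
     kkt_point objective (constraint \<sigma> Pt)
       (index_sets (uncertainty_set hhat \<delta>) (uncertainty_set hhat \<delta>)) x"

definition sampled_kkt_point ::
  "real \<Rightarrow> real \<Rightarrow> ('k \<Rightarrow> (complex^'n) set) \<Rightarrow> ('k \<Rightarrow> (complex^'n) set) \<Rightarrow>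
   ('n::finite, 'k::finite) point \<Rightarrow> bool" where
  "sampled_kkt_point \<sigma> Pt H Hc x \<longleftrightarrow>
     kkt_point_finite objective (constraint \<sigma> Pt) (index_sets H Hc) x"


section \<open>The cutting-set algorithm\<close>

text \<open>Initialization and update of the sample sets, for iterates \<open>x i\<close> and channels \<open>h i k\<close>,
  \<open>hc i k\<close> returned by the pessimization step. Iterations are numbered from 1; \<open>H i\<close> and \<open>Hc i\<close>
  are the sets used in the optimization step of iteration \<open>i\<close>.\<close>

definition cutting_set_updates ::
  "real \<Rightarrow> ('k \<Rightarrow> complex^'n) \<Rightarrow>
   (nat \<Rightarrow> 'k \<Rightarrow> (complex^'n) set) \<Rightarrow> (nat \<Rightarrow> 'k \<Rightarrow> (complex^'n) set) \<Rightarrow>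
   (nat \<Rightarrow> ('n::finite, 'k::finite) point) \<Rightarrow>
   (nat \<Rightarrow> 'k \<Rightarrow> complex^'n) \<Rightarrow> (nat \<Rightarrow> 'k \<Rightarrow> complex^'n) \<Rightarrow> bool" where
  "cutting_set_updates \<sigma> hhat H Hc x h hc \<longleftrightarrow>
     (\<forall>k. H 1 k = {hhat k} \<and> Hc 1 k = {hhat k}) \<and>
     (\<forall>i\<ge>1. \<forall>k.
        H (Suc i) k =
          (if private_rate \<sigma> (P_of (x i)) k (h i k) + C_of (x i) $ k < Rt_of (x i)
           then insert (h i k) (H i k) else H i k) \<and>
        Hc (Suc i) k =
          (if common_rate \<sigma> (P_of (x i)) (hc i k) < (\<Sum>l\<in>UNIV. C_of (x i) $ l)
           then insert (hc i k) (Hc i k) else Hc i k))"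

definition exact_pessimization ::
  "real \<Rightarrow> ('k \<Rightarrow> complex^'n) \<Rightarrow> ('k \<Rightarrow> real) \<Rightarrow> ('n::finite, 'k::finite) point \<Rightarrow>
   ('k \<Rightarrow> complex^'n) \<Rightarrow> ('k \<Rightarrow> complex^'n) \<Rightarrow> bool" where
  "exact_pessimization \<sigma> hhat \<delta> x h hc \<longleftrightarrow>
     (\<forall>k. is_arg_min (private_rate \<sigma> (P_of x) k) (\<lambda>g. g \<in> uncertainty_set hhat \<delta> k) (h k) \<and>
          is_arg_min (common_rate \<sigma> (P_of x)) (\<lambda>g. g \<in> uncertainty_set hhat \<delta> k) (hc k))"

text \<open>Convergence of a sequence to a set. Nonemptiness is required because
  \<open>infdist a {} = 0\<close>.\<close>

definition converges_to_set :: "(nat \<Rightarrow> 'a::metric_space) \<Rightarrow> 'a set \<Rightarrow> bool" where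
  "converges_to_set X S \<longleftrightarrow> S \<noteq> {} \<and> (\<lambda>i. infdist (X i) S) \<longlonglongrightarrow> 0"

end

theory Submission
  imports Defs
begin

text \<open>The iterates are bounded, so it suffices that every cluster point is a KKT point. Cluster
  points are feasible because every cut is kept. For the multipliers, stationarity in
  \<open>R\<^sub>t\<close> gives the private ones total mass 1, stationarity in \<open>c\<close> controls the common and sign
  multipliers after a normalization, and the power multiplier is bounded by testing stationarity
  in the direction of the precoder itself, which has squared norm \<open>P\<^sub>t\<close> when the power
  constraint is active. With bounded mass the limit stationarity condition lies in the convex hull
  of a compact set of (gradient, constraint value) pairs, so no weak-star compactness is needed:
  the limit multipliers can be taken finitely supported.\<close>

section \<open>Continuously differentiable families\<close>

text \<open>The obstacle is that the multipliers of the sampled problems need not be bounded. When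
  \<open>c\<close> is zero and the common rate vanishes at some sampled channel, for instance with a
  zero common precoder, the gradient of that common constraint is the opposite of the sum of the
  gradients of the sign constraints. Equal amounts can then be added to all these multipliers
  without disturbing stationarity or complementarity, so the multipliers that come with the iterates
  may blow up along the sequence. This is why they are replaced, at the same iterate, by normalized
  ones before any limit is taken. No other degeneracy has to be excluded: the private mass is fixed
  by the objective, and the power gradient is bounded away from zero whenever the power constraint
  is active, since \<open>Pt\<close> is positive.\<close>

definition C1_family :: "('x::euclidean_space \<Rightarrow> 't::topological_space \<Rightarrow> real) \<Rightarrow> bool" where
  "C1_family f \<longleftrightarrow> continuous_on UNIV (\<lambda>p. f (fst p) (snd p)) \<and>
     (\<exists>G. continuous_on UNIV (\<lambda>p. G (fst p) (snd p)) \<and> (\<forall>y t. GDERIV (\<lambda>z. f z t) y :> G y t))"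

lemma C1_familyI:
  assumes "continuous_on UNIV (\<lambda>p. f (fst p) (snd p))"
    and "continuous_on UNIV (\<lambda>p. G (fst p) (snd p))"
    and "\<And>y t. GDERIV (\<lambda>z. f z t) y :> G y t"
  shows "C1_family f"
  using assms unfolding C1_family_def by blast

lemma C1_family_GDERIV:
  assumes "C1_family f"
  shows "GDERIV (\<lambda>z. f z t) y :> gradient (\<lambda>z. f z t) y"
  using assms unfolding C1_family_def by (metis gradient_eqI)

lemma C1_family_continuous:
  assumes "C1_family f"
  shows "continuous_on UNIV (\<lambda>p. f (fst p) (snd p))"
  using assms unfolding C1_family_def by blast

text \<open>Gradients are unique, so the continuity of the existential witness passes to
  \<open>gradient\<close>. Joint continuity in variable and index is what later allows compactness
  over both at once.\<close>

lemma C1_family_continuous_gradient: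
  assumes "C1_family f"
  shows "continuous_on UNIV (\<lambda>p. gradient (\<lambda>z. f z (snd p)) (fst p))"
proof -
  obtain G where G: "continuous_on UNIV (\<lambda>p. G (fst p) (snd p))"
      "\<And>y t. GDERIV (\<lambda>z. f z t) y :> G y t"
    using assms unfolding C1_family_def by blast
  have "gradient (\<lambda>z. f z t) y = G y t" for y t
    by (rule gradient_eqI) (rule G)
  with G(1) show ?thesis by simp
qed

lemma C1_family_const:
  assumes "continuous_on UNIV g"
  shows "C1_family (\<lambda>y t. g t)"
proof (rule C1_familyI[where G = "\<lambda>y t. 0"])
  show "continuous_on UNIV (\<lambda>p. g (snd p))"
    by (rule continuous_on_compose2[OF assms]) (auto intro: continuous_intros)
qed (auto intro: continuous_intros GDERIV_const)

lemma C1_family_linear: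
  fixes L :: "'x::euclidean_space \<Rightarrow> real"
  assumes "bounded_linear L"
  shows "C1_family (\<lambda>y (t::'t::topological_space). L y)"
proof (rule C1_familyI[where G = "\<lambda>y t. \<Sum>b\<in>Basis. L b *\<^sub>R b"])
  interpret bounded_linear L by fact
  show "continuous_on UNIV (\<lambda>p::'x \<times> 't. L (fst p))"
    by (intro continuous_on continuous_intros)
  have "h \<bullet> (\<Sum>b\<in>Basis. L b *\<^sub>R b) = L h" for h
  proof -
    have "L h = L (\<Sum>b\<in>Basis. (h \<bullet> b) *\<^sub>R b)"
      by (simp add: euclidean_representation)
    also have "\<dots> = (\<Sum>b\<in>Basis. (h \<bullet> b) * L b)"
      by (simp add: sum scaleR)
    finally show ?thesis
      by (simp add: inner_sum_right mult.commute)
  qed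
  then have "(\<lambda>h. h \<bullet> (\<Sum>b\<in>Basis. L b *\<^sub>R b)) = L"
    by blast
  then show "GDERIV (\<lambda>z. L z) y :> (\<Sum>b\<in>Basis. L b *\<^sub>R b)" for y
    unfolding gderiv_def by (simp add: bounded_linear_imp_has_derivative assms)
qed (intro continuous_intros)

lemma C1_family_add:
  assumes "C1_family f" "C1_family g"
  shows "C1_family (\<lambda>y t. f y t + g y t)"
  by (rule C1_familyI[OF _ _ GDERIV_add[OF assms[THEN C1_family_GDERIV]]])
    (intro continuous_intros C1_family_continuous C1_family_continuous_gradient assms)+

lemma C1_family_diff:
  assumes "C1_family f" "C1_family g"
  shows "C1_family (\<lambda>y t. f y t - g y t)"
  by (rule C1_familyI[OF _ _ GDERIV_diff[OF assms[THEN C1_family_GDERIV]]])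
    (intro continuous_intros C1_family_continuous C1_family_continuous_gradient assms)+

lemma C1_family_mult:
  assumes "C1_family f" "C1_family g"
  shows "C1_family (\<lambda>y t. f y t * g y t)"
  by (rule C1_familyI[OF _ _ GDERIV_mult[OF assms[THEN C1_family_GDERIV]]])
    (intro continuous_intros C1_family_continuous C1_family_continuous_gradient assms)+

lemma C1_family_sum:
  assumes "finite I" "\<And>i. i \<in> I \<Longrightarrow> C1_family (f i)"
  shows "C1_family (\<lambda>y t. \<Sum>i\<in>I. f i y t)"
  using assms
  by (induction I rule: finite_induct)
    (simp_all add: C1_family_add C1_family_const)

text \<open>The outer function needs to be smooth only on the positive reals, which admits both
  \<open>inverse\<close> and \<open>log 2\<close>.\<close>

lemma C1_family_compose:
  assumes f: "C1_family f" and pos: "\<And>y t. f y t > 0"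
    and \<phi>: "\<And>r. r > 0 \<Longrightarrow> (\<phi> has_real_derivative \<phi>' r) (at r)"
    and \<phi>': "continuous_on {0<..} \<phi>'"
  shows "C1_family (\<lambda>y t. \<phi> (f y t))"
proof (rule C1_familyI[OF _ _ GDERIV_DERIV_compose[OF C1_family_GDERIV[OF f] \<phi>[OF pos]]])
  have "continuous_on {0<..} \<phi>"
    using \<phi> by (meson DERIV_isCont continuous_at_imp_continuous_on greaterThan_iff)
  then show "continuous_on UNIV (\<lambda>p. \<phi> (f (fst p) (snd p)))"
    by (rule continuous_on_compose2) (use pos C1_family_continuous[OF f] in auto)
  show "continuous_on UNIV
      (\<lambda>p. \<phi>' (f (fst p) (snd p)) *\<^sub>R gradient (\<lambda>z. f z (snd p)) (fst p))"
    using pos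
    by (intro continuous_intros C1_family_continuous_gradient f
        continuous_on_compose2[OF \<phi>' C1_family_continuous[OF f]]) auto
qed

lemma GDERIV_direction:
  assumes "GDERIV f y :> D"
  shows "((\<lambda>s. f (y + s *\<^sub>R v)) has_real_derivative (v \<bullet> D)) (at 0)"
proof -
  have "((\<lambda>s. y + s *\<^sub>R v) has_derivative (\<lambda>s. s *\<^sub>R v)) (at 0)"
    by (auto intro!: derivative_eq_intros)
  moreover have "(f has_derivative (\<lambda>h. h \<bullet> D)) (at (y + 0 *\<^sub>R v))"
    using assms by (simp add: gderiv_def)
  ultimately have "((\<lambda>s. f (y + s *\<^sub>R v)) has_derivative (\<lambda>s. (s *\<^sub>R v) \<bullet> D)) (at 0)"
    by (rule has_derivative_compose)
  moreover have "(\<lambda>s. (s *\<^sub>R v) \<bullet> D) = (*) (v \<bullet> D)"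
    by (auto simp: mult.commute)
  ultimately show ?thesis
    unfolding has_field_derivative_def by simp
qed

text \<open>The multiplier estimates see a gradient only through its inner products with directions,
  each of them a one-variable derivative; thus no gradient of a rate is ever written out.\<close>

lemma C1_family_direction:
  assumes "C1_family f"
    and "((\<lambda>s. f (y + s *\<^sub>R v) t) has_real_derivative d) (at 0)"
  shows "v \<bullet> gradient (\<lambda>z. f z t) y = d"
  using DERIV_unique[OF GDERIV_direction[OF C1_family_GDERIV[OF assms(1)]] assms(2)] .


section \<open>Limits of points with bounded multipliers\<close>

text \<open>\<open>point_measure\<close> has all subsets of \<open>A\<close> as measurable sets;
  pushing it forward along the identity moves its point masses to the Borel sets of
  \<open>T\<close>, as \<open>kkt_point\<close> demands.\<close>

definition discrete_measure :: "'t::topological_space set \<Rightarrow> 't set \<Rightarrow> ('t \<Rightarrow> real) \<Rightarrow> 't measure" where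
  "discrete_measure T A w =
     distr (point_measure A (\<lambda>t. ennreal (w t))) (restrict_space borel T) (\<lambda>t. t)"

lemma measurable_discrete_measure:
  assumes "A \<subseteq> T"
  shows "(\<lambda>t. t) \<in> measurable (point_measure A w) (restrict_space borel T)"
  using assms by (auto simp: measurable_def point_measure_def space_restrict_space)

lemma sets_discrete_measure:
  "sets (discrete_measure T A w) = sets (restrict_space borel T)"
  by (simp add: discrete_measure_def)

lemma finite_measure_discrete_measure:
  assumes "finite A" "A \<subseteq> T"
  shows "finite_measure (discrete_measure T A w)"
  unfolding discrete_measure_def
proof (rule finite_measure.finite_measure_distr)
  show "finite_measure (point_measure A (\<lambda>t. ennreal (w t)))"
    by (rule finite_measureI)
      (simp add: space_point_measure emeasure_point_measure_finite assms less_top)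
qed (rule measurable_discrete_measure[OF assms(2)])

lemma integral_discrete_measure:
  fixes g :: "'t::topological_space \<Rightarrow> 'b::euclidean_space"
  assumes "finite A" "A \<subseteq> T" "\<And>t. t \<in> A \<Longrightarrow> w t \<ge> 0" "continuous_on UNIV g"
  shows "(\<integral>t. g t \<partial>discrete_measure T A w) = (\<Sum>t\<in>A. w t *\<^sub>R g t)"
proof -
  have "g \<in> borel_measurable (restrict_space borel T)"
    using assms(4) by (intro measurable_restrict_space1) (rule borel_measurable_continuous_onI)
  then have "(\<integral>t. g t \<partial>discrete_measure T A w) =
      (\<integral>t. g t \<partial>point_measure A (\<lambda>t. ennreal (w t)))"
    unfolding discrete_measure_def
    by (intro integral_distr measurable_discrete_measure assms)
  also have "\<dots> = (\<Sum>t\<in>A. w t *\<^sub>R g t)"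
    by (rule lebesgue_integral_point_measure_finite) (use assms in auto)
  finally show ?thesis .
qed

lemma kkt_pointI_convex_hull:
  fixes f :: "'m::finite \<Rightarrow> 'x::euclidean_space \<Rightarrow> 't::topological_space \<Rightarrow> real"
  assumes C1: "\<And>m. C1_family (f m)" and feas: "feasible f T a" and c: "c > 0"
    and hull: "(- (c *\<^sub>R gradient f0 a), 0) \<in>
      convex hull (insert 0 (\<Union>m. (\<lambda>t. (gradient (\<lambda>z. f m z t) a, f m a t)) ` T m))"
  shows "kkt_point f0 f T a"
proof -
  define g where "g m t = (gradient (\<lambda>z. f m z t) a, f m a t)" for m t
  obtain S u where S: "finite S" "S \<subseteq> insert 0 (\<Union>m. g m ` T m)" and u: "\<forall>v\<in>S. 0 \<le> u v"
    and S_sum: "(\<Sum>v\<in>S. u v *\<^sub>R v) = (- (c *\<^sub>R gradient f0 a), 0)"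
    using hull unfolding convex_hull_explicit g_def by blast
  \<comment> \<open>Several pairs of constraint and index may yield the same vector. One pair is
    chosen for each; the choice is injective because \<open>g\<close> recovers the vector from the
    pair.\<close>
  have "\<forall>v\<in>S - {0}. \<exists>p. snd p \<in> T (fst p) \<and> v = g (fst p) (snd p)"
    using S(2) by fastforce
  then obtain pick where pick: "\<And>v. v \<in> S - {0} \<Longrightarrow>
      snd (pick v) \<in> T (fst (pick v)) \<and> v = g (fst (pick v)) (snd (pick v))"
    by metis
  define A where "A m = {t. (m, t) \<in> pick ` (S - {0})}" for m
  define w where "w m t = u (g m t) / c" for m t
  have Sigma_A: "Sigma UNIV A = pick ` (S - {0})"
    by (auto simp: A_def)
  have A_fin: "finite (A m)" for m
  proof (rule finite_subset)
    show "A m \<subseteq> snd ` pick ` (S - {0})"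
      unfolding A_def by (metis (no_types, lifting) image_eqI mem_Collect_eq snd_conv subsetI)
  qed (use S(1) in auto)
  have A_sub: "A m \<subseteq> T m" for m
  proof
    fix t assume "t \<in> A m"
    then obtain v where "v \<in> S - {0}" "pick v = (m, t)" unfolding A_def by (metis (no_types, lifting) imageE mem_Collect_eq)
    then show "t \<in> T m" using pick[of v] by simp
  qed
  have w_nonneg: "w m t \<ge> 0" if "t \<in> A m" for m t
  proof -
    obtain v where "v \<in> S - {0}" "pick v = (m, t)"
      using \<open>t \<in> A m\<close> unfolding A_def by (metis (no_types, lifting) imageE mem_Collect_eq)
    then have "g m t \<in> S" using pick[of v] by simp
    then show ?thesis using u c by (simp add: w_def)
  qed
  have inj: "inj_on pick (S - {0})"
    by (rule inj_onI) (metis pick)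
  have total: "(\<Sum>m\<in>UNIV. \<Sum>t\<in>A m. w m t *\<^sub>R g m t) = (- gradient f0 a, 0)"
  proof -
    have "(\<Sum>m\<in>UNIV. \<Sum>t\<in>A m. w m t *\<^sub>R g m t) =
        (\<Sum>(m, t)\<in>pick ` (S - {0}). w m t *\<^sub>R g m t)"
      using A_fin by (simp add: sum.Sigma Sigma_A)
    also have "\<dots> = (\<Sum>v\<in>S - {0}. (1 / c) *\<^sub>R (u v *\<^sub>R v))"
      unfolding sum.reindex[OF inj]
      by (rule sum.cong) (use pick in \<open>auto simp: w_def case_prod_beta\<close>)
    also have "\<dots> = (\<Sum>v\<in>S. (1 / c) *\<^sub>R (u v *\<^sub>R v))"
      by (rule sum.mono_neutral_left) (use S in auto)
    also have "\<dots> = (1 / c) *\<^sub>R (- (c *\<^sub>R gradient f0 a), 0)"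
      by (simp only: scaleR_sum_right[symmetric] S_sum)
    finally show ?thesis using c by simp
  qed
  have grad0: "gradient f0 a + (\<Sum>m\<in>UNIV. \<Sum>t\<in>A m. w m t *\<^sub>R gradient (\<lambda>z. f m z t) a) = 0"
    using arg_cong[OF total, of fst] by (simp add: fst_sum g_def)
  have "(\<Sum>m\<in>UNIV. \<Sum>t\<in>A m. w m t * f m a t) = 0"
    using arg_cong[OF total, of snd] by (simp add: snd_sum g_def)
  moreover have "(\<Sum>t\<in>A m. w m t * f m a t) \<le> 0" for m
    using feas A_sub w_nonneg unfolding feasible_def
    by (intro sum_nonpos mult_nonneg_nonpos) auto
  ultimately have compl: "(\<Sum>t\<in>A m. w m t * f m a t) = 0" for m
    using sum_nonneg_eq_0_iff[of UNIV "\<lambda>m. - (\<Sum>t\<in>A m. w m t * f m a t)"]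
    by (auto simp: sum_negf)
  have cont: "continuous_on UNIV (\<lambda>t. f m a t)"
      "continuous_on UNIV (\<lambda>t. gradient (\<lambda>z. f m z t) a)" for m
  proof -
    have "continuous_on UNIV (\<lambda>t. (a, t))" by (intro continuous_intros)
    then show "continuous_on UNIV (\<lambda>t. f m a t)"
        "continuous_on UNIV (\<lambda>t. gradient (\<lambda>z. f m z t) a)"
      using continuous_on_compose2[OF C1_family_continuous[OF C1[of m]], of UNIV "\<lambda>t. (a, t)"]
        continuous_on_compose2[OF C1_family_continuous_gradient[OF C1[of m]], of UNIV "\<lambda>t. (a, t)"]
      by auto
  qed
  show ?thesis
    unfolding kkt_point_def
  proof (intro conjI exI allI feas)
    fix m
    let ?\<mu> = "\<lambda>m. discrete_measure (T m) (A m) (w m)"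
    show "finite_measure (?\<mu> m)"
      by (rule finite_measure_discrete_measure[OF A_fin A_sub])
    show "sets (?\<mu> m) = sets (restrict_space borel (T m))"
      by (rule sets_discrete_measure)
    show "gradient f0 a + (\<Sum>m\<in>UNIV. \<integral>t. gradient (\<lambda>y. f m y t) a \<partial>?\<mu> m) = 0"
      using grad0 by (simp add: integral_discrete_measure[OF A_fin A_sub w_nonneg cont(2)])
    show "(\<integral>t. f m a t \<partial>?\<mu> m) = 0"
      using compl by (simp add: integral_discrete_measure[OF A_fin A_sub w_nonneg cont(1)])
  qed
qed

text \<open>With the multipliers frozen, replacing the iterates by their limit changes the stationarity
  residual and the complementarity residual by \<open>o(1)\<close>, and the perturbed sums stay in the convex
  hull of a compact set, which is closed.\<close>

lemma kkt_point_limit: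
  fixes f :: "'m::finite \<Rightarrow> 'x::euclidean_space \<Rightarrow> 't::metric_space \<Rightarrow> real"
  assumes C1: "\<And>m. C1_family (f m)" and f0: "\<And>y. gradient f0 y = d"
    and T: "\<And>m. compact (T m)" and feas: "feasible f T a" and X: "X \<longlonglongrightarrow> a"
    and S: "\<And>i m. finite (S i m)" "\<And>i m. S i m \<subseteq> T m"
    and \<mu>: "\<And>i m t. t \<in> S i m \<Longrightarrow> \<mu> i m t \<ge> 0"
    and mass: "\<And>i. (\<Sum>m\<in>UNIV. \<Sum>t\<in>S i m. \<mu> i m t) \<le> M"
    and stat: "\<And>i. d + (\<Sum>m\<in>UNIV. \<Sum>t\<in>S i m. \<mu> i m t *\<^sub>R gradient (\<lambda>z. f m z t) (X i)) = 0"
    and compl: "\<And>i. (\<Sum>m\<in>UNIV. \<Sum>t\<in>S i m. \<mu> i m t * f m (X i) t) = 0"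
  shows "kkt_point f0 f T a"
proof -
  \<comment> \<open>Scaling by \<open>c\<close> brings every mass down to at most 1; the maximum
    keeps \<open>c\<close> positive whatever the sign of \<open>M\<close>.\<close>
  define c where "c = 1 / max M 1"
  have c: "c > 0" by (simp add: c_def)
  define g where "g m p = (gradient (\<lambda>z. f m z (snd p)) (fst p), f m (fst p) (snd p))" for m p
  have g_cont: "continuous_on A (g m)" for m A
    unfolding g_def
    by (rule continuous_on_subset[OF _ subset_UNIV])
      (intro continuous_on_Pair C1_family_continuous_gradient C1_family_continuous C1)
  define B where "B = insert 0 (\<Union>m. (\<lambda>t. g m (a, t)) ` T m)"
  have "compact B"
    unfolding B_def
    by (intro compact_insert compact_UN finite compact_continuous_image T
        continuous_on_compose2[OF g_cont]) (auto intro!: continuous_intros)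
  then have K: "closed (convex hull B)"
    by (intro compact_imp_closed compact_convex_hull)
  define v where "v i = (\<Sum>m\<in>UNIV. \<Sum>t\<in>S i m. (c * \<mu> i m t) *\<^sub>R g m (a, t))" for i
  have c_mass: "(\<Sum>m\<in>UNIV. \<Sum>t\<in>S i m. c * \<mu> i m t) \<le> 1" for i
  proof -
    have "(\<Sum>m\<in>UNIV. \<Sum>t\<in>S i m. c * \<mu> i m t) = c * (\<Sum>m\<in>UNIV. \<Sum>t\<in>S i m. \<mu> i m t)"
      by (simp add: sum_distrib_left)
    also have "\<dots> \<le> c * max M 1"
      using mass[of i] c by (intro mult_left_mono) auto
    also have "\<dots> = 1"
      by (simp add: c_def)
    finally show ?thesis .
  qed
  have v_in: "v i \<in> convex hull B" for i
  proof -
    let ?s = "\<Sum>m\<in>UNIV. \<Sum>t\<in>S i m. c * \<mu> i m t"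
    \<comment> \<open>The index \<open>None\<close> puts the leftover weight \<open>1 - ?s\<close>
      on the point 0 of \<open>B\<close>.\<close>
    let ?I = "insert None (Some ` Sigma UNIV (S i))"
    let ?w = "\<lambda>p. case p of None \<Rightarrow> 1 - ?s | Some (m, t) \<Rightarrow> c * \<mu> i m t"
    let ?y = "\<lambda>p. case p of None \<Rightarrow> 0 | Some (m, t) \<Rightarrow> g m (a, t)"
    have fin: "finite (Sigma UNIV (S i))" using S(1) by auto
    have "(\<Sum>p\<in>?I. ?w p *\<^sub>R ?y p) \<in> convex hull B"
    proof (rule convex_sum)
      show "sum ?w ?I = 1"
        using fin S(1) by (simp add: sum.reindex sum.Sigma split_def)
      show "?w p \<ge> 0" if "p \<in> ?I" for p
        using that c_mass[of i] \<mu> c by auto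
      show "?y p \<in> convex hull B" if "p \<in> ?I" for p
      proof (rule hull_inc)
        show "?y p \<in> B"
          using that subsetD[OF S(2)] by (cases p) (fastforce simp: B_def)+
      qed
    qed (use fin in auto)
    also have "(\<Sum>p\<in>?I. ?w p *\<^sub>R ?y p) = v i"
      using fin S(1) by (simp add: sum.reindex sum.Sigma split_def v_def)
    finally show ?thesis .
  qed
  have v_lim: "v \<longlonglongrightarrow> (- (c *\<^sub>R d), 0)"
  proof (rule metric_LIMSEQ_I)
    fix e :: real assume e: "e > 0"
    \<comment> \<open>The samples change with \<open>i\<close>, so continuity in the variable must
      be uniform over \<open>T m\<close>. The unit ball around \<open>a\<close> makes the domain
      compact, and \<open>\<rho> \<le> 1\<close> keeps the late iterates inside it.\<close>
    have "\<forall>m. \<exists>r>0. \<forall>p\<in>cball a 1 \<times> T m. \<forall>q\<in>cball a 1 \<times> T m.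
        dist q p < r \<longrightarrow> dist (g m q) (g m p) < e / 2"
      using compact_uniformly_continuous[OF g_cont compact_Times[OF compact_cball T]] e
      unfolding uniformly_continuous_on_def by (meson half_gt_zero)
    then obtain r where r: "\<And>m. r m > 0"
        "\<And>m p q. p \<in> cball a 1 \<times> T m \<Longrightarrow> q \<in> cball a 1 \<times> T m \<Longrightarrow> dist q p < r m \<Longrightarrow>
          dist (g m q) (g m p) < e / 2"
      by metis
    define \<rho> where "\<rho> = Min (insert 1 (range r))"
    have \<rho>: "\<rho> > 0" "\<rho> \<le> 1"
      using r(1) by (auto simp: \<rho>_def)
    have \<rho>_le: "\<rho> \<le> r m" for m
      unfolding \<rho>_def by (rule Min_le) auto
    obtain N where N: "\<And>i. i \<ge> N \<Longrightarrow> dist (X i) a < \<rho>"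
      using metric_LIMSEQ_D[OF X \<rho>(1)] by blast
    have "dist (v i) (- (c *\<^sub>R d), 0) < e" if "i \<ge> N" for i
    proof -
      have diff: "norm (g m (a, t) - g m (X i, t)) \<le> e / 2" if "t \<in> S i m" for m t
      proof -
        have "dist (a, t) (X i, t) < r m" "X i \<in> cball a 1" "t \<in> T m"
          using N[OF \<open>i \<ge> N\<close>] \<rho>(2) \<rho>_le[of m] S(2) that by (auto simp: dist_Pair_Pair dist_commute)
        then show ?thesis
          using r(2)[of "(X i, t)" m "(a, t)"] by (auto simp: dist_norm)
      qed
      \<comment> \<open>At the iterate itself the sum is exact, so the whole error comes from moving
        \<open>X i\<close> to \<open>a\<close>.\<close>
      have "(\<Sum>m\<in>UNIV. \<Sum>t\<in>S i m. \<mu> i m t *\<^sub>R g m (X i, t)) = (- d, 0)"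
        using stat[of i] compl[of i]
        by (intro prod_eqI) (auto simp: fst_sum snd_sum g_def eq_neg_iff_add_eq_0 add.commute)
      then have "(\<Sum>m\<in>UNIV. \<Sum>t\<in>S i m. (c * \<mu> i m t) *\<^sub>R g m (X i, t)) = c *\<^sub>R (- d, 0)"
        by (simp only: scaleR_sum_right[symmetric] scaleR_scaleR[symmetric])
      then have "v i - (- (c *\<^sub>R d), 0) =
          (\<Sum>m\<in>UNIV. \<Sum>t\<in>S i m. (c * \<mu> i m t) *\<^sub>R (g m (a, t) - g m (X i, t)))"
        by (simp add: v_def scaleR_diff_right sum_subtractf)
      also have "norm \<dots> \<le> (\<Sum>m\<in>UNIV. \<Sum>t\<in>S i m. (c * \<mu> i m t) * (e / 2))"
        using diff \<mu> c
        by (intro sum_norm_le) (auto intro!: mult_mono)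
      also have "\<dots> = (\<Sum>m\<in>UNIV. \<Sum>t\<in>S i m. c * \<mu> i m t) * (e / 2)"
        by (simp add: sum_distrib_right)
      also have "\<dots> \<le> 1 * (e / 2)"
        using c_mass[of i] e by (intro mult_right_mono) auto
      finally show ?thesis using e by (simp add: dist_norm)
    qed
    then show "\<exists>N. \<forall>i\<ge>N. dist (v i) (- (c *\<^sub>R d), 0) < e" by blast
  qed
  have "(- (c *\<^sub>R d), 0) \<in> convex hull B"
    by (rule closed_sequentially[OF K v_in v_lim])
  then show ?thesis
    using C1 feas c by (intro kkt_pointI_convex_hull[of f T a c]) (auto simp: f0 B_def g_def)
qed


section \<open>The constraints\<close>

lemma Rt_of_line [simp]: "Rt_of (y + s *\<^sub>R v) = Rt_of y + s * Rt_of v"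
  by (simp add: Rt_of_def)

lemma C_of_line [simp]: "C_of (y + s *\<^sub>R v) = C_of y + s *\<^sub>R C_of v"
  by (simp add: C_of_def)

lemma P_of_line [simp]: "P_of (y + s *\<^sub>R v) = P_of y + s *\<^sub>R P_of v"
  by (simp add: P_of_def)

lemma trace_mult_conj_transpose:
  fixes P :: "('n::finite, 'k::finite) precoder"
  shows "Re (trace (P ** conj_transpose P)) = P \<bullet> P"
proof -
  have "Re (z * cnj z) = z \<bullet> z" for z :: complex
    by (simp add: inner_complex_def)
  then show ?thesis
    by (simp add: trace_def conj_transpose_def matrix_matrix_mult_def inner_vec_def)
qed

section \<open>Smoothness of the rates and of the constraints\<close>

lemma C1_family_P_of:
  assumes "bounded_linear L"
  shows "C1_family (\<lambda>(y::('n::finite, 'k::finite) point) t. L (P_of y $ j $ s))"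
  unfolding P_of_def
  by (intro C1_family_linear bounded_linear_compose[OF assms]
      bounded_linear_compose[OF bounded_linear_vec_nth] bounded_linear_snd_comp bounded_linear_snd)

text \<open>The squared modulus is a polynomial in real and imaginary parts; this form avoids the
  modulus, which is not differentiable at 0.\<close>

lemma C1_family_gain:
  "C1_family (\<lambda>(y::('n::finite, 'k::finite) point) t. (cmod (herm_inner t (column s (P_of y))))\<^sup>2)"
proof -
  let ?re = "\<lambda>(y::('n, 'k) point) t. \<Sum>j\<in>UNIV.
    Re (t $ j) * Re (P_of y $ j $ s) + Im (t $ j) * Im (P_of y $ j $ s)"
  let ?im = "\<lambda>(y::('n, 'k) point) t. \<Sum>j\<in>UNIV.
    Re (t $ j) * Im (P_of y $ j $ s) - Im (t $ j) * Re (P_of y $ j $ s)"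
  have "C1_family ?re"
    by (intro C1_family_sum C1_family_add C1_family_mult C1_family_const C1_family_P_of
        bounded_linear_Re bounded_linear_Im finite continuous_intros)
  moreover have "C1_family ?im"
    by (intro C1_family_sum C1_family_diff C1_family_mult C1_family_const C1_family_P_of
        bounded_linear_Re bounded_linear_Im finite continuous_intros)
  ultimately have "C1_family (\<lambda>y t. ?re y t * ?re y t + ?im y t * ?im y t)"
    by (intro C1_family_add C1_family_mult)
  moreover have "(cmod (herm_inner t (column s (P_of y))))\<^sup>2 =
      ?re y t * ?re y t + ?im y t * ?im y t" for y t
    by (simp add: cmod_power2 herm_inner_def column_def flip: power2_eq_square)
  ultimately show ?thesis by simp
qed

lemma C1_family_log_ratio:
  assumes f: "C1_family f" "\<And>y t. f y t \<ge> 0" and g: "C1_family g" "\<And>y t. g y t > 0"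
  shows "C1_family (\<lambda>y t. log 2 (1 + f y t / g y t))"
  unfolding divide_inverse
proof (rule C1_family_compose[where \<phi> = "log 2" and \<phi>' = "\<lambda>r. 1 / (ln 2 * r)"])
  have "C1_family (\<lambda>y t. inverse (g y t))"
    by (rule C1_family_compose[OF g, where \<phi>' = "\<lambda>r. - (inverse r ^ 2)"])
      (auto intro!: continuous_intros DERIV_inverse derivative_eq_intros simp: power2_eq_square)
  then show "C1_family (\<lambda>y t. 1 + f y t * inverse (g y t))"
    by (intro C1_family_add C1_family_mult C1_family_const f) auto
  show "1 + f y t * inverse (g y t) > 0" for y t
    using f(2)[of y t] g(2)[of y t] by (simp add: add_pos_nonneg)
  show "(log 2 has_real_derivative 1 / (ln 2 * r)) (at r)" if "r > 0" for r :: real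
    using DERIV_log[OF that, of 2] by simp
  show "continuous_on {0<..} (\<lambda>r::real. 1 / (ln 2 * r))"
    by (intro continuous_intros) auto
qed

lemma interference_pos: "(\<sigma>::real) \<noteq> 0 \<Longrightarrow> (\<Sum>i\<in>A. (f i)\<^sup>2) + \<sigma>\<^sup>2 > 0"
  by (simp add: add_nonneg_pos sum_nonneg)

lemma C1_family_common_rate:
  assumes "\<sigma> \<noteq> 0"
  shows "C1_family (\<lambda>(y::('n::finite, 'k::finite) point) t. common_rate \<sigma> (P_of y) t)"
  unfolding common_rate_def
  by (intro C1_family_log_ratio C1_family_gain C1_family_add C1_family_sum C1_family_const
      interference_pos assms) auto

lemma C1_family_private_rate:
  assumes "\<sigma> \<noteq> 0"
  shows "C1_family (\<lambda>(y::('n::finite, 'k::finite) point) t. private_rate \<sigma> (P_of y) k t)"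
  unfolding private_rate_def
  by (intro C1_family_log_ratio C1_family_gain C1_family_add C1_family_sum C1_family_const
      interference_pos assms) auto

lemma log_ratio_nonneg: "(a::real) \<ge> 0 \<Longrightarrow> b \<ge> 0 \<Longrightarrow> log 2 (1 + a / b) \<ge> 0"
  by (subst zero_le_log_cancel_iff) (auto simp: add_pos_nonneg)

lemma rate_nonneg:
  "common_rate \<sigma> P t \<ge> 0" "private_rate \<sigma> P k t \<ge> 0"
  unfolding common_rate_def private_rate_def
  by (intro log_ratio_nonneg add_nonneg_nonneg sum_nonneg zero_le_power2)+

lemma C1_family_constraint:
  fixes m :: "'k::finite constr"
  assumes "\<sigma> \<noteq> 0"
  shows "C1_family (constraint \<sigma> Pt m :: ('n::finite, 'k) point \<Rightarrow> _)"
proof -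
  have R: "C1_family (\<lambda>(y::('n, 'k) point) (t::complex^'n). Rt_of y)"
    unfolding Rt_of_def by (intro C1_family_linear bounded_linear_fst)
  have C: "C1_family (\<lambda>(y::('n, 'k) point) (t::complex^'n). C_of y $ k)" for k
    unfolding C_of_def
    by (intro C1_family_linear bounded_linear_compose[OF bounded_linear_vec_nth]
        bounded_linear_fst_comp bounded_linear_snd)
  have "C1_family (\<lambda>y t. constraint \<sigma> Pt m (y::('n, 'k) point) t)"
  proof (cases m)
    case (Private k)
    then show ?thesis
      by (simp add: C1_family_diff C1_family_add R C C1_family_private_rate assms)
  next
    case (Common k)
    then show ?thesis
      by (simp add: C1_family_diff C1_family_sum C C1_family_common_rate assms)
  next
    case (Nonneg k)
    then show ?thesis
      using C1_family_diff[OF C1_family_const C[of k], of "\<lambda>_. 0"] by simp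
  next
    case Power
    have "C1_family (\<lambda>(y::('n, 'k) point) (t::complex^'n). \<Sum>j\<in>UNIV. \<Sum>s\<in>UNIV.
        Re (P_of y $ j $ s) * Re (P_of y $ j $ s) + Im (P_of y $ j $ s) * Im (P_of y $ j $ s))"
      by (intro C1_family_sum C1_family_add C1_family_mult C1_family_P_of
          bounded_linear_Re bounded_linear_Im finite)
    then show ?thesis
      using Power
      by (simp add: trace_mult_conj_transpose inner_vec_def inner_complex_def
          C1_family_diff C1_family_const)
  qed
  then show ?thesis by simp
qed

section \<open>Inner products of the constraint gradients with chosen directions\<close>

definition constraint_gradient ::
  "real \<Rightarrow> real \<Rightarrow> 'k constr \<Rightarrow> ('n::finite, 'k::finite) point \<Rightarrow> complex^'n \<Rightarrow> ('n, 'k) point" where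
  "constraint_gradient \<sigma> Pt m y t = gradient (\<lambda>z. constraint \<sigma> Pt m z t) y"

lemma gradient_objective:
  "gradient objective (y::('n::finite, 'k::finite) point) = (- 1, 0, 0)"
proof (rule gradient_eqI)
  have "bounded_linear (\<lambda>y::('n, 'k) point. - fst y)"
    by (intro bounded_linear_minus bounded_linear_fst)
  moreover have "(\<lambda>h::('n, 'k) point. h \<bullet> (- 1, 0, 0)) = (\<lambda>h. - fst h)"
    by (auto simp: inner_prod_def)
  ultimately show "GDERIV objective y :> (- 1, 0, 0)"
    unfolding gderiv_def objective_def Rt_of_def
    by (simp add: bounded_linear_imp_has_derivative)
qed

context
  fixes \<sigma> Pt :: real and y v :: "('n::finite, 'k::finite) point" and t :: "complex^'n"
  assumes \<sigma>: "\<sigma> \<noteq> 0"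
begin

text \<open>A direction that fixes the precoder fixes the rate, so only the linear terms in
  \<open>R_t\<close> and \<open>c\<close> contribute.\<close>

lemma inner_gradient_Private:
  assumes "P_of v = 0"
  shows "v \<bullet> constraint_gradient \<sigma> Pt (Private k) y t = Rt_of v - C_of v $ k"
  unfolding constraint_gradient_def
  by (rule C1_family_direction[OF C1_family_constraint[OF \<sigma>]])
    (auto simp: assms intro!: derivative_eq_intros)

lemma inner_gradient_Common:
  assumes "P_of v = 0"
  shows "v \<bullet> constraint_gradient \<sigma> Pt (Common k) y t = (\<Sum>l\<in>UNIV. C_of v $ l)"
  unfolding constraint_gradient_def
  by (rule C1_family_direction[OF C1_family_constraint[OF \<sigma>]])
    (auto simp: assms intro!: derivative_eq_intros)

lemma inner_gradient_Nonneg: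
  "v \<bullet> constraint_gradient \<sigma> Pt (Nonneg k) y t = - (C_of v $ k)"
  unfolding constraint_gradient_def
  by (rule C1_family_direction[OF C1_family_constraint[OF \<sigma>]])
    (auto intro!: derivative_eq_intros)

lemma inner_gradient_Power:
  "v \<bullet> constraint_gradient \<sigma> Pt Power y t = 2 * (P_of y \<bullet> P_of v)"
  unfolding constraint_gradient_def
proof (rule C1_family_direction[OF C1_family_constraint[OF \<sigma>]])
  have "((\<lambda>s. P_of y \<bullet> P_of y + 2 * s * (P_of y \<bullet> P_of v) + s * s * (P_of v \<bullet> P_of v) - Pt)
      has_real_derivative 2 * (P_of y \<bullet> P_of v)) (at 0)"
    by (auto intro!: derivative_eq_intros)
  then show "((\<lambda>s. constraint \<sigma> Pt Power (y + s *\<^sub>R v) t)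
      has_real_derivative 2 * (P_of y \<bullet> P_of v)) (at 0)"
    by (simp add: trace_mult_conj_transpose inner_add_left inner_add_right inner_commute
        algebra_simps)
qed

text \<open>A vanishing common rate is minimal, so its gradient vanishes and only the linear part of the
  constraint contributes.\<close>

lemma inner_gradient_Common_zero:
  assumes "common_rate \<sigma> (P_of y) t = 0"
  shows "v \<bullet> constraint_gradient \<sigma> Pt (Common k) y t = (\<Sum>l\<in>UNIV. C_of v $ l)"
  unfolding constraint_gradient_def
proof (rule C1_family_direction[OF C1_family_constraint[OF \<sigma>]])
  let ?\<rho> = "\<lambda>s. common_rate \<sigma> (P_of (y + s *\<^sub>R v)) t"
  obtain d where d: "(?\<rho> has_real_derivative d) (at 0)"
    using GDERIV_direction[OF C1_family_GDERIV[OF C1_family_common_rate[OF \<sigma>]]] by blast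
  moreover have "d = 0"
    by (rule DERIV_local_min[OF d zero_less_one]) (simp add: assms rate_nonneg)
  ultimately show "((\<lambda>s. constraint \<sigma> Pt (Common k) (y + s *\<^sub>R v) t)
      has_real_derivative (\<Sum>l\<in>UNIV. C_of v $ l)) (at 0)"
    by (auto intro!: derivative_eq_intros)
qed

end


section \<open>Multipliers of the sampled problems\<close>

lemma sum_constr:
  fixes g :: "'k::finite constr \<Rightarrow> 'b::comm_monoid_add"
  shows "(\<Sum>m\<in>UNIV. g m) =
    (\<Sum>k\<in>UNIV. g (Private k)) + (\<Sum>k\<in>UNIV. g (Common k)) + (\<Sum>k\<in>UNIV. g (Nonneg k)) + g Power"
proof -
  have UNIV_eq: "UNIV = range Private \<union> (range Common \<union> (range Nonneg \<union> {Power :: 'k constr}))"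
  proof (rule UNIV_eq_I)
    show "m \<in> range Private \<union> (range Common \<union> (range Nonneg \<union> {Power}))" for m :: "'k constr"
      by (cases m) auto
  qed
  have "sum g UNIV = sum g (range Private) +
      (sum g (range Common) + (sum g (range Nonneg) + sum g {Power}))"
    unfolding UNIV_eq by (subst sum.union_disjoint, simp, simp, force)+ simp
  then show ?thesis
    by (simp add: sum.reindex inj_on_def add.assoc)
qed

text \<open>Complementarity is stored pointwise instead of as one vanishing sum per index set. At a
  feasible point all terms have the same sign, so nothing is lost, and a nonzero multiplier directly
  marks an active constraint.\<close>

definition sampled_multipliers ::
  "real \<Rightarrow> real \<Rightarrow> ('k \<Rightarrow> (complex^'n) set) \<Rightarrow> ('k \<Rightarrow> (complex^'n) set) \<Rightarrow>
   ('n::finite, 'k::finite) point \<Rightarrow> ('k constr \<Rightarrow> complex^'n \<Rightarrow> real) \<Rightarrow> bool" where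
  "sampled_multipliers \<sigma> Pt H Hc y \<mu> \<longleftrightarrow>
    (\<forall>m. \<forall>t\<in>index_sets H Hc m. \<mu> m t \<ge> 0 \<and> \<mu> m t * constraint \<sigma> Pt m y t = 0) \<and>
    gradient objective y + (\<Sum>m\<in>UNIV. \<Sum>t\<in>index_sets H Hc m.
      \<mu> m t *\<^sub>R constraint_gradient \<sigma> Pt m y t) = 0"

lemma sampled_kkt_pointD:
  assumes "sampled_kkt_point \<sigma> Pt H Hc y"
  shows "finite (index_sets H Hc m)" "feasible (constraint \<sigma> Pt) (index_sets H Hc) y"
  using assms by (simp_all add: sampled_kkt_point_def kkt_point_finite_def)

lemma sampled_kkt_point_multipliers:
  assumes "sampled_kkt_point \<sigma> Pt H Hc y"
  obtains \<mu> where "sampled_multipliers \<sigma> Pt H Hc y \<mu>"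
proof -
  let ?T = "index_sets H Hc"
  obtain \<mu> where \<mu>: "\<And>m t. t \<in> ?T m \<Longrightarrow> \<mu> m t \<ge> 0"
    and stat: "gradient objective y + (\<Sum>m\<in>UNIV. \<Sum>t\<in>?T m.
      \<mu> m t *\<^sub>R constraint_gradient \<sigma> Pt m y t) = 0"
    and compl: "\<And>m. (\<Sum>t\<in>?T m. \<mu> m t * constraint \<sigma> Pt m y t) = 0"
    using assms unfolding sampled_kkt_point_def kkt_point_finite_def constraint_gradient_def
    by blast
  have "\<mu> m t * constraint \<sigma> Pt m y t = 0" if "t \<in> ?T m" for m t
  proof -
    have "- (\<mu> m t * constraint \<sigma> Pt m y t) \<ge> 0" if "t \<in> ?T m" for t
      using \<mu>[OF that] sampled_kkt_pointD(2)[OF assms] that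
      by (auto simp: feasible_def mult_nonneg_nonpos)
    then show ?thesis
      using sum_nonneg_eq_0_iff[of "?T m" "\<lambda>t. - (\<mu> m t * constraint \<sigma> Pt m y t)"]
        sampled_kkt_pointD(1)[OF assms] compl[of m] that
      by (auto simp: sum_negf)
  qed
  with \<mu> stat show ?thesis
    by (intro that[of \<mu>]) (auto simp: sampled_multipliers_def)
qed

section \<open>Mass bounds for the multipliers of one sampled problem\<close>

context
  fixes \<sigma> Pt :: real and H Hc :: "'k::finite \<Rightarrow> (complex^'n::finite) set"
    and y :: "('n, 'k) point" and \<mu> :: "'k constr \<Rightarrow> complex^'n \<Rightarrow> real"
  assumes \<sigma>: "\<sigma> \<noteq> 0" and \<mu>: "sampled_multipliers \<sigma> Pt H Hc y \<mu>"
begin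

lemma multiplier_nonneg: "t \<in> index_sets H Hc m \<Longrightarrow> \<mu> m t \<ge> 0"
  using \<mu> by (simp add: sampled_multipliers_def)

lemma multiplier_eq_0: "t \<in> index_sets H Hc m \<Longrightarrow> \<mu> m t * constraint \<sigma> Pt m y t = 0"
  using \<mu> by (simp add: sampled_multipliers_def)

lemma stationarity_split:
  "gradient objective y +
    ((\<Sum>k\<in>UNIV. \<Sum>t\<in>H k. \<mu> (Private k) t *\<^sub>R constraint_gradient \<sigma> Pt (Private k) y t) +
     (\<Sum>k\<in>UNIV. \<Sum>t\<in>Hc k. \<mu> (Common k) t *\<^sub>R constraint_gradient \<sigma> Pt (Common k) y t) +
     (\<Sum>k\<in>UNIV. \<mu> (Nonneg k) 0 *\<^sub>R constraint_gradient \<sigma> Pt (Nonneg k) y 0) +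
     \<mu> Power 0 *\<^sub>R constraint_gradient \<sigma> Pt Power y 0) = 0"
  using \<mu> by (simp add: sampled_multipliers_def sum_constr)

lemma stationarity_direction:
  "- Rt_of v +
    ((\<Sum>k\<in>UNIV. \<Sum>t\<in>H k. \<mu> (Private k) t * (v \<bullet> constraint_gradient \<sigma> Pt (Private k) y t)) +
     (\<Sum>k\<in>UNIV. \<Sum>t\<in>Hc k. \<mu> (Common k) t * (v \<bullet> constraint_gradient \<sigma> Pt (Common k) y t)) +
     (\<Sum>k\<in>UNIV. \<mu> (Nonneg k) 0 * - (C_of v $ k)) +
     \<mu> Power 0 * (2 * (P_of y \<bullet> P_of v))) = 0"
proof -
  have "v \<bullet> gradient objective y = - Rt_of v"
    by (simp add: gradient_objective inner_prod_def Rt_of_def)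
  then show ?thesis
    using arg_cong[OF stationarity_split, of "\<lambda>w. v \<bullet> w"]
    by (simp add: inner_add_right inner_sum_right inner_gradient_Nonneg[OF \<sigma>]
        inner_gradient_Power[OF \<sigma>])
qed

text \<open>The test direction raises \<open>R_t\<close> alone: the objective contributes -1, each
  private constraint 1, everything else 0.\<close>

lemma private_mass: "(\<Sum>k\<in>UNIV. \<Sum>t\<in>H k. \<mu> (Private k) t) = 1"
  using stationarity_direction[of "(1, 0, 0)"]
  by (simp add: inner_gradient_Private[OF \<sigma>] inner_gradient_Common[OF \<sigma>]
      Rt_of_def C_of_def P_of_def)

lemma private_mass_le: "(\<Sum>t\<in>H k. \<mu> (Private k) t) \<le> 1"
proof -
  have "(\<Sum>t\<in>H k. \<mu> (Private k) t) \<le> (\<Sum>k\<in>UNIV. \<Sum>t\<in>H k. \<mu> (Private k) t)"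
    by (rule member_le_sum) (auto intro!: sum_nonneg multiplier_nonneg)
  then show ?thesis by (simp add: private_mass)
qed

text \<open>Raising \<open>C l\<close> alone tightens every common constraint at unit rate and
  relaxes only the private constraints and the sign constraint of user \<open>l\<close>.\<close>

lemma common_mass:
  "(\<Sum>k\<in>UNIV. \<Sum>t\<in>Hc k. \<mu> (Common k) t) = (\<Sum>t\<in>H l. \<mu> (Private l) t) + \<mu> (Nonneg l) 0"
proof -
  have delta: "(\<Sum>k\<in>UNIV. \<Sum>t\<in>H k. \<mu> (Private k) t * - (axis l 1 $ k)) =
      - (\<Sum>t\<in>H l. \<mu> (Private l) t)"
  proof -
    have "(\<Sum>k\<in>UNIV. \<Sum>t\<in>H k. \<mu> (Private k) t * - (axis l 1 $ k)) =
        (\<Sum>k\<in>UNIV. if k = l then - (\<Sum>t\<in>H k. \<mu> (Private k) t) else 0)"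
      by (intro sum.cong) (auto simp: axis_def sum_negf)
    then show ?thesis by simp
  qed
  have delta': "(\<Sum>k\<in>UNIV. \<mu> (Nonneg k) 0 * - (axis l 1 $ k)) = - \<mu> (Nonneg l) 0"
  proof -
    have "(\<Sum>k\<in>UNIV. \<mu> (Nonneg k) 0 * - (axis l 1 $ k)) =
        (\<Sum>k\<in>UNIV. if k = l then - \<mu> (Nonneg k) 0 else 0)"
      by (intro sum.cong) (auto simp: axis_def)
    then show ?thesis by simp
  qed
  have "(\<Sum>k\<in>UNIV. axis l (1::real) $ k) = 1"
    by (simp add: axis_def)
  then show ?thesis
    using stationarity_direction[of "(0, axis l 1, 0)"] delta delta'
    by (simp add: inner_gradient_Private[OF \<sigma>] inner_gradient_Common[OF \<sigma>]
        Rt_of_def C_of_def P_of_def sum_negf)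
qed

text \<open>If some \<open>C k\<close> is positive then its multiplier vanishes and the common mass equals a private
  one. If all are zero, then the active common gradients all equal minus the sum of the gradients
  of the sign constraints, so that common mass in excess of 1 can be cancelled against the
  multipliers of the sign constraints.\<close>

lemma common_mass_normalized:
  assumes feas: "feasible (constraint \<sigma> Pt) (index_sets H Hc) y"
  obtains \<mu>' where "sampled_multipliers \<sigma> Pt H Hc y \<mu>'"
    "(\<Sum>k\<in>UNIV. \<Sum>t\<in>Hc k. \<mu>' (Common k) t) \<le> 1"
proof (cases "(\<Sum>k\<in>UNIV. \<Sum>t\<in>Hc k. \<mu> (Common k) t) \<le> 1")
  case True
  with \<mu> that show ?thesis by blast
next
  case False
  define \<Lambda> where "\<Lambda> = (\<Sum>k\<in>UNIV. \<Sum>t\<in>Hc k. \<mu> (Common k) t)"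
  \<comment> \<open>\<open>E\<close> represents the functional that sums the components of
    \<open>c\<close>.\<close>
  define E :: "('n, 'k) point" where "E = (0, (\<chi> k. 1), 0)"
  have \<Lambda>: "\<Lambda> > 1" using False by (simp add: \<Lambda>_def)
  have \<nu>: "\<mu> (Nonneg k) 0 \<ge> \<Lambda> - 1" for k
    using common_mass[of k] private_mass_le[of k] by (simp add: \<Lambda>_def)
  have C: "C_of y $ k = 0" for k
    using multiplier_eq_0[of 0 "Nonneg k"] \<Lambda> \<nu>[of k] by auto
  have inner_E: "v \<bullet> E = (\<Sum>l\<in>UNIV. C_of v $ l)" for v
    by (simp add: E_def inner_prod_def C_of_def inner_vec_def)
  have common: "\<mu> (Common k) t *\<^sub>R constraint_gradient \<sigma> Pt (Common k) y t = \<mu> (Common k) t *\<^sub>R E"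
    if "t \<in> Hc k" for k t
  proof (cases "\<mu> (Common k) t = 0")
    case False
    then have "common_rate \<sigma> (P_of y) t = 0"
      using multiplier_eq_0[of t "Common k"] that by (simp add: C)
    then have "v \<bullet> constraint_gradient \<sigma> Pt (Common k) y t = v \<bullet> E" for v
      by (simp add: inner_gradient_Common_zero[OF \<sigma>] inner_E)
    then have "constraint_gradient \<sigma> Pt (Common k) y t = E"
      by (rule vector_eq_ldot[THEN iffD1, OF allI])
    then show ?thesis by simp
  qed simp
  have common_sum: "(\<Sum>k\<in>UNIV. \<Sum>t\<in>Hc k.
      \<mu> (Common k) t *\<^sub>R constraint_gradient \<sigma> Pt (Common k) y t) = \<Lambda> *\<^sub>R E"
    by (simp add: common \<Lambda>_def scaleR_sum_left)
  have "v \<bullet> (\<Sum>k\<in>UNIV. constraint_gradient \<sigma> Pt (Nonneg k) y 0) = v \<bullet> (- E)" for v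
    by (simp add: inner_sum_right inner_gradient_Nonneg[OF \<sigma>] inner_E sum_negf)
  then have nonneg_sum: "(\<Sum>k\<in>UNIV. constraint_gradient \<sigma> Pt (Nonneg k) y 0) = - E"
    by (rule vector_eq_ldot[THEN iffD1, OF allI])
  \<comment> \<open>Dividing by \<open>\<Lambda>\<close> removes
    \<open>(\<Lambda> - 1) *\<^sub>R E\<close> from the common terms; lowering every sign multiplier
    by \<open>\<Lambda> - 1\<close> restores it, because the sign gradients sum to
    \<open>- E\<close>. Nonnegativity survives by \<open>\<nu>\<close>, complementarity by
    \<open>C\<close>.\<close>
  define \<mu>' where "\<mu>' m t = (case m of Common k \<Rightarrow> \<mu> m t / \<Lambda> | Nonneg k \<Rightarrow> \<mu> m t - (\<Lambda> - 1) |
    _ \<Rightarrow> \<mu> m t)" for m t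
  have \<mu>'_simps: "\<mu>' (Private k) t = \<mu> (Private k) t" "\<mu>' (Common k) t = \<mu> (Common k) t / \<Lambda>"
      "\<mu>' (Nonneg k) t = \<mu> (Nonneg k) t - (\<Lambda> - 1)" "\<mu>' Power t = \<mu> Power t" for k t
    by (simp_all add: \<mu>'_def)
  have common_sum': "(\<Sum>k\<in>UNIV. \<Sum>t\<in>Hc k.
      \<mu>' (Common k) t *\<^sub>R constraint_gradient \<sigma> Pt (Common k) y t) = E"
  proof -
    have "(\<Sum>k\<in>UNIV. \<Sum>t\<in>Hc k. \<mu>' (Common k) t *\<^sub>R constraint_gradient \<sigma> Pt (Common k) y t) =
        (1 / \<Lambda>) *\<^sub>R (\<Lambda> *\<^sub>R E)"
      unfolding common_sum[symmetric] by (simp add: \<mu>'_simps scaleR_sum_right)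
    then show ?thesis using \<Lambda> by simp
  qed
  have nonneg_sum': "(\<Sum>k\<in>UNIV. \<mu>' (Nonneg k) 0 *\<^sub>R constraint_gradient \<sigma> Pt (Nonneg k) y 0) =
      (\<Sum>k\<in>UNIV. \<mu> (Nonneg k) 0 *\<^sub>R constraint_gradient \<sigma> Pt (Nonneg k) y 0) + (\<Lambda> - 1) *\<^sub>R E"
    by (simp add: \<mu>'_simps scaleR_diff_left[of _ "\<Lambda> - 1"] sum_subtractf nonneg_sum
        flip: scaleR_sum_right)
  have "sampled_multipliers \<sigma> Pt H Hc y \<mu>'"
    unfolding sampled_multipliers_def
  proof (intro conjI allI ballI)
    fix m t assume t: "t \<in> index_sets H Hc m"
    show "\<mu>' m t \<ge> 0"
      using multiplier_nonneg[OF t] \<nu> \<Lambda> t by (cases m) (auto simp: \<mu>'_simps)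
    show "\<mu>' m t * constraint \<sigma> Pt m y t = 0"
      using multiplier_eq_0[OF t] by (cases m) (auto simp: \<mu>'_simps C)
  next
    show "gradient objective y + (\<Sum>m\<in>UNIV. \<Sum>t\<in>index_sets H Hc m.
        \<mu>' m t *\<^sub>R constraint_gradient \<sigma> Pt m y t) = 0"
      using stationarity_split
      by (simp add: sum_constr common_sum common_sum' nonneg_sum' \<mu>'_simps(1,4))
        (simp add: algebra_simps)
  qed
  moreover have "(\<Sum>k\<in>UNIV. \<Sum>t\<in>Hc k. \<mu>' (Common k) t) = 1"
    using \<Lambda> by (simp add: \<mu>'_simps \<Lambda>_def[symmetric] flip: sum_divide_distrib)
  ultimately show ?thesis by (intro that) auto
qed

text \<open>The bound adds 1 for the private mass, 1 for the common mass, 1 for each sign multiplier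
  (none exceeds the common mass) and \<open>B / sqrt Pt\<close> for the power multiplier. It does
  not involve the number of samples.\<close>

lemma multiplier_mass_bound:
  assumes Pt: "Pt > 0" and common: "(\<Sum>k\<in>UNIV. \<Sum>t\<in>Hc k. \<mu> (Common k) t) \<le> 1"
    and B: "B \<ge> 0" "\<And>m t. t \<in> index_sets H Hc m \<Longrightarrow> norm (constraint_gradient \<sigma> Pt m y t) \<le> B"
  shows "(\<Sum>m\<in>UNIV. \<Sum>t\<in>index_sets H Hc m. \<mu> m t) \<le> 2 + real CARD('k) + B / sqrt Pt"
proof -
  have "\<mu> (Nonneg k) 0 \<le> 1" for k
    using common_mass[of k] common sum_nonneg[of "H k" "\<mu> (Private k)"]
      multiplier_nonneg[of _ "Private k"] by simp
  then have nonneg: "(\<Sum>k\<in>UNIV. \<mu> (Nonneg k) 0) \<le> real CARD('k)"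
    using sum_bounded_above[of UNIV "\<lambda>k. \<mu> (Nonneg k) 0" 1] by simp
  have "\<mu> Power 0 \<le> B / sqrt Pt"
  proof (cases "\<mu> Power 0 = 0")
    case False
    then have P: "P_of y \<bullet> P_of y = Pt"
      using multiplier_eq_0[of 0 Power] by (simp add: trace_mult_conj_transpose)
    \<comment> \<open>Along the precoder the power gradient contributes \<open>2 * Pt\<close>, while
      the private and the common terms, each of mass at most 1, contribute at least
      \<open>- (sqrt Pt * B)\<close> apiece.\<close>
    define v :: "('n, 'k) point" where "v = (0, 0, P_of y)"
    have v: "norm v = sqrt Pt" "Rt_of v = 0" "C_of v = 0" "P_of v = P_of y"
      using P by (simp_all add: v_def Rt_of_def C_of_def P_of_def norm_Pair norm_eq_sqrt_inner)
    have lower: "\<mu> m t * (v \<bullet> constraint_gradient \<sigma> Pt m y t) \<ge> \<mu> m t * - (sqrt Pt * B)"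
      if "t \<in> index_sets H Hc m" for m t
    proof (rule mult_left_mono[OF _ multiplier_nonneg[OF that]])
      have "\<bar>v \<bullet> constraint_gradient \<sigma> Pt m y t\<bar> \<le> norm v * norm (constraint_gradient \<sigma> Pt m y t)"
        by (rule Cauchy_Schwarz_ineq2)
      also have "\<dots> \<le> sqrt Pt * B"
        unfolding v(1) using B(2)[OF that] Pt by (intro mult_left_mono) auto
      finally show "- (sqrt Pt * B) \<le> v \<bullet> constraint_gradient \<sigma> Pt m y t" by linarith
    qed
    have "(\<Sum>k\<in>UNIV. \<Sum>t\<in>H k. \<mu> (Private k) t * (v \<bullet> constraint_gradient \<sigma> Pt (Private k) y t)) \<ge>
        (\<Sum>k\<in>UNIV. \<Sum>t\<in>H k. \<mu> (Private k) t * - (sqrt Pt * B))"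
      by (intro sum_mono lower) simp
    also have "(\<Sum>k\<in>UNIV. \<Sum>t\<in>H k. \<mu> (Private k) t * - (sqrt Pt * B)) = - (sqrt Pt * B)"
      unfolding sum_distrib_right[symmetric] private_mass by simp
    finally have private_ge: "- (sqrt Pt * B) \<le> (\<Sum>k\<in>UNIV. \<Sum>t\<in>H k.
        \<mu> (Private k) t * (v \<bullet> constraint_gradient \<sigma> Pt (Private k) y t))" .
    have "(\<Sum>k\<in>UNIV. \<Sum>t\<in>Hc k. \<mu> (Common k) t * (v \<bullet> constraint_gradient \<sigma> Pt (Common k) y t)) \<ge>
        (\<Sum>k\<in>UNIV. \<Sum>t\<in>Hc k. \<mu> (Common k) t * - (sqrt Pt * B))"
      by (intro sum_mono lower) simp
    also have "(\<Sum>k\<in>UNIV. \<Sum>t\<in>Hc k. \<mu> (Common k) t * - (sqrt Pt * B)) =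
        (\<Sum>k\<in>UNIV. \<Sum>t\<in>Hc k. \<mu> (Common k) t) * - (sqrt Pt * B)"
      by (simp only: sum_distrib_right)
    also have "\<dots> \<ge> 1 * - (sqrt Pt * B)"
      using common B(1) Pt by (intro mult_right_mono_neg) auto
    finally have "2 * (\<mu> Power 0 * Pt) \<le> 2 * (sqrt Pt * B)"
      using stationarity_direction[of v] private_ge by (simp add: v P)
    then have "\<mu> Power 0 * Pt \<le> B * sqrt Pt"
      by (simp add: mult.commute)
    moreover have "\<mu> Power 0 * Pt = (\<mu> Power 0 * sqrt Pt) * sqrt Pt"
      using Pt by simp
    ultimately have "(\<mu> Power 0 * sqrt Pt) * sqrt Pt \<le> B * sqrt Pt"
      by linarith
    then have "\<mu> Power 0 * sqrt Pt \<le> B"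
      using Pt by (simp only: mult_le_cancel_right_pos real_sqrt_gt_0_iff)
    then show ?thesis
      using Pt by (simp add: pos_le_divide_eq)
  qed (use B(1) Pt in simp)
  with nonneg common show ?thesis
    by (simp add: sum_constr private_mass)
qed

text \<open>Feasibility bounds \<open>R_t\<close> only from above. The lower bound needs
  stationarity: the private mass is 1, so some private constraint is active and \<open>R_t\<close>
  equals a rate plus a component of \<open>c\<close>.\<close>

lemma Rt_of_nonneg:
  assumes "\<And>k. C_of y $ k \<ge> 0"
  shows "Rt_of y \<ge> 0"
proof -
  have "\<exists>k. \<exists>t\<in>H k. \<mu> (Private k) t \<noteq> 0"
  proof (rule ccontr)
    assume "\<not> ?thesis"
    then have "(\<Sum>k\<in>UNIV. \<Sum>t\<in>H k. \<mu> (Private k) t) = 0" by simp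
    then show False using private_mass by simp
  qed
  then obtain k t where "t \<in> H k" "\<mu> (Private k) t \<noteq> 0" by blast
  then have "Rt_of y = private_rate \<sigma> (P_of y) k t + C_of y $ k"
    using multiplier_eq_0[of t "Private k"] by simp
  then show ?thesis using assms[of k] rate_nonneg(2)[of \<sigma> "P_of y" k t] by simp
qed

end


section \<open>Convergence of the cutting-set algorithm\<close>

text \<open>A cut generated at a violated iterate is respected by all later ones, hence by the limit.
  Along a subsequence the worst-case channels converge, and the limit channel is a worst case for
  the limit point.\<close>

lemma cutting_set_limit_feasible:
  fixes g :: "'x::metric_space \<Rightarrow> 't::metric_space \<Rightarrow> real"
  assumes cont: "continuous_on UNIV (\<lambda>p. g (fst p) (snd p))" and T: "compact T"
    and X: "X \<longlonglongrightarrow> a" and q: "\<And>j. q j \<in> T"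
    and worst: "\<And>j t. t \<in> T \<Longrightarrow> g (X j) t \<le> g (X j) (q j)"
    and cut: "\<And>j j'. j < j' \<Longrightarrow> g (X j) (q j) > 0 \<Longrightarrow> g (X j') (q j) \<le> 0"
    and t: "t \<in> T"
  shows "g a t \<le> 0"
proof -
  have g_lim: "(\<lambda>j. g (u j) (w j)) \<longlonglongrightarrow> g b c" if "u \<longlonglongrightarrow> b" "w \<longlonglongrightarrow> c" for u w b c
    using continuous_on_tendsto_compose[OF cont tendsto_Pair[OF that]] by simp
  obtain z r where r: "strict_mono r" and z: "(q \<circ> r) \<longlonglongrightarrow> z"
    using T q unfolding compact_def by metis
  have Xr: "(\<lambda>j. X (r j)) \<longlonglongrightarrow> a"
    using LIMSEQ_subseq_LIMSEQ[OF X r] by (simp add: comp_def)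
  have qr: "(\<lambda>j. q (r j)) \<longlonglongrightarrow> z"
    using z by (simp add: comp_def)
  have "g a z \<le> 0"
  proof (rule ccontr)
    assume "\<not> g a z \<le> 0"
    then have pos: "g a z > 0" by simp
    \<comment> \<open>Two sequences tend to the positive value \<open>g a z\<close>: positivity
      along \<open>(X (r j), q (r j))\<close> triggers a cut, and positivity along
      \<open>(a, q (r j))\<close> says that \<open>a\<close> violates this cut.\<close>
    have "\<forall>\<^sub>F j in sequentially. g (X (r j)) (q (r j)) > 0 \<and> g a (q (r j)) > 0"
      by (intro eventually_conj order_tendstoD(1)[OF g_lim pos] Xr qr tendsto_const)
    then obtain j where j: "g (X (r j)) (q (r j)) > 0" "g a (q (r j)) > 0"
      using eventually_happens'[OF sequentially_bot] by blast
    have "g a (q (r j)) \<le> 0"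
      by (rule LIMSEQ_le_const2[OF g_lim[OF X tendsto_const]])
        (use cut[OF _ j(1)] in \<open>auto intro!: exI[of _ "Suc (r j)"]\<close>)
    with j(2) show False by simp
  qed
  moreover have "g a t \<le> g a z"
    by (rule LIMSEQ_le[OF g_lim[OF Xr tendsto_const] g_lim[OF Xr qr]]) (use worst[OF t] in auto)
  ultimately show ?thesis by simp
qed

text \<open>Iterations are numbered from 1 and \<open>x 0\<close> is arbitrary, so subsequences must
  avoid the index 0.\<close>

lemma subsequence_ge_1:
  fixes r :: "nat \<Rightarrow> nat"
  assumes "strict_mono r" "r 0 \<ge> 1"
  shows "r j \<ge> 1"
  using strict_mono_leD[OF assms(1), of 0 j] assms(2) by simp

lemma compact_index_sets:
  "compact (index_sets (uncertainty_set hhat \<delta>) (uncertainty_set hhat \<delta>) m)"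
proof -
  have "uncertainty_set hhat \<delta> k = cball (hhat k) (\<delta> k)" for k
    by (auto simp: uncertainty_set_def dist_norm norm_minus_commute)
  then show ?thesis by (cases m) auto
qed

section \<open>Sample sets, iterates and cluster points of one run of the algorithm\<close>

context
  fixes \<sigma> Pt :: real
    and hhat :: "'k::finite \<Rightarrow> complex^'n::finite" and \<delta> :: "'k \<Rightarrow> real"
    and H Hc :: "nat \<Rightarrow> 'k \<Rightarrow> (complex^'n) set"
    and x :: "nat \<Rightarrow> ('n, 'k) point"
    and h hc :: "nat \<Rightarrow> 'k \<Rightarrow> complex^'n"
  assumes \<sigma>: "\<sigma> \<noteq> 0" and Pt: "Pt > 0" and \<delta>: "\<And>k. \<delta> k \<ge> 0"
    and updates: "cutting_set_updates \<sigma> hhat H Hc x h hc"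
    and opt: "\<And>i. i \<ge> 1 \<Longrightarrow> sampled_kkt_point \<sigma> Pt (H i) (Hc i) (x i)"
    and pess: "\<And>i. i \<ge> 1 \<Longrightarrow> exact_pessimization \<sigma> hhat \<delta> (x i) (h i) (hc i)"
begin

abbreviation "full_sets \<equiv> index_sets (uncertainty_set hhat \<delta>) (uncertainty_set hhat \<delta>)"

lemma samples_init: "H 1 k = {hhat k}" "Hc 1 k = {hhat k}"
  using updates by (simp_all add: cutting_set_updates_def)

lemma samples_step:
  assumes "i \<ge> 1"
  shows "H (Suc i) k = (if constraint \<sigma> Pt (Private k) (x i) (h i k) > 0
      then insert (h i k) (H i k) else H i k)"
    and "Hc (Suc i) k = (if constraint \<sigma> Pt (Common k) (x i) (hc i k) > 0
      then insert (hc i k) (Hc i k) else Hc i k)"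
  using updates assms by (simp_all add: cutting_set_updates_def)

lemma worst_channels:
  assumes "i \<ge> 1"
  shows "h i k \<in> uncertainty_set hhat \<delta> k" "hc i k \<in> uncertainty_set hhat \<delta> k"
    and "g \<in> uncertainty_set hhat \<delta> k \<Longrightarrow>
      constraint \<sigma> Pt (Private k) (x i) g \<le> constraint \<sigma> Pt (Private k) (x i) (h i k)"
    and "g \<in> uncertainty_set hhat \<delta> k \<Longrightarrow>
      constraint \<sigma> Pt (Common k) (x i) g \<le> constraint \<sigma> Pt (Common k) (x i) (hc i k)"
  using pess[OF assms] by (auto simp: exact_pessimization_def is_arg_min_def not_less)

lemma samples_subset:
  assumes "i \<ge> 1"
  shows "H i k \<subseteq> uncertainty_set hhat \<delta> k \<and> Hc i k \<subseteq> uncertainty_set hhat \<delta> k"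
  using assms
proof (induction i rule: dec_induct)
  case base
  then show ?case
    using \<delta> by (simp add: samples_init[unfolded One_nat_def] uncertainty_set_def)
next
  case (step i)
  then show ?case
    using worst_channels(1,2)[of i k] by (simp add: samples_step)
qed

lemma samples_mono:
  assumes "1 \<le> i" "i \<le> j"
  shows "H i k \<subseteq> H j k \<and> Hc i k \<subseteq> Hc j k"
  using assms(2)
proof (induction j rule: dec_induct)
  case (step j)
  then show ?case using assms(1) by (auto simp: samples_step)
qed simp

text \<open>The nominal channels are never discarded, so the rate constraints at them bound all
  iterates alike.\<close>

lemma hhat_in_samples:
  assumes "i \<ge> 1"
  shows "hhat k \<in> H i k" "hhat k \<in> Hc i k"
  using samples_mono[OF order_refl assms, of k] samples_init[of k] by auto

lemma index_sets_subset:
  assumes "i \<ge> 1"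
  shows "index_sets (H i) (Hc i) m \<subseteq> full_sets m"
  using samples_subset[OF assms] by (cases m) auto

lemma iterate_feasible:
  assumes "i \<ge> 1" "t \<in> index_sets (H i) (Hc i) m"
  shows "constraint \<sigma> Pt m (x i) t \<le> 0"
  using sampled_kkt_pointD(2)[OF opt[OF assms(1)]] assms(2) by (simp add: feasible_def)

lemma cuts_respected:
  assumes "1 \<le> i" "i < j"
  shows "constraint \<sigma> Pt (Private k) (x i) (h i k) > 0 \<Longrightarrow>
      constraint \<sigma> Pt (Private k) (x j) (h i k) \<le> 0"
    and "constraint \<sigma> Pt (Common k) (x i) (hc i k) > 0 \<Longrightarrow>
      constraint \<sigma> Pt (Common k) (x j) (hc i k) \<le> 0"
proof -
  have j: "j \<ge> 1" "1 \<le> Suc i" "Suc i \<le> j" using assms by auto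
  note step = samples_step[OF assms(1)] samples_mono[OF j(2,3), of k]
  show "constraint \<sigma> Pt (Private k) (x j) (h i k) \<le> 0"
    if "constraint \<sigma> Pt (Private k) (x i) (h i k) > 0"
    using step that by (intro iterate_feasible[OF j(1)]) (auto split: if_splits)
  show "constraint \<sigma> Pt (Common k) (x j) (hc i k) \<le> 0"
    if "constraint \<sigma> Pt (Common k) (x i) (hc i k) > 0"
    using step that by (intro iterate_feasible[OF j(1)]) (auto split: if_splits)
qed

text \<open>The power constraint bounds the precoder, hence the rates at the nominal channels by
  some \<open>b\<close>. The common constraints then bound each component of \<open>c\<close> by
  \<open>b\<close>, and the private ones bound \<open>R_t\<close> by \<open>2 * b\<close>; from
  below \<open>R_t\<close> is bounded by \<open>Rt_of_nonneg\<close>.\<close>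

lemma iterates_bounded: "bounded (x ` {1..})"
proof -
  \<comment> \<open>Rates depend on the precoder alone; the zeros merely complete it to a point, so
    that continuity of the rate families applies on a compact set.\<close>
  define Y :: "('n, 'k) point set" where "Y = {0} \<times> {0} \<times> cball 0 (sqrt Pt)"
  have Y: "compact Y"
    unfolding Y_def by (intro compact_Times compact_cball) auto
  define Rates where "Rates = (\<Union>k. (\<lambda>y. common_rate \<sigma> (P_of y) (hhat k)) ` Y \<union>
    (\<lambda>y. private_rate \<sigma> (P_of y) k (hhat k)) ` Y)"
  have slice: "continuous_on Y (\<lambda>y. f y (t::complex^'n))"
    if "C1_family f" for t and f :: "('n, 'k) point \<Rightarrow> _"
  proof -
    have "continuous_on Y (\<lambda>y. (y, t))" by (intro continuous_intros)
    then show ?thesis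
      using continuous_on_compose2[OF C1_family_continuous[OF that], of Y "\<lambda>y. (y, t)"] by simp
  qed
  have "compact Rates"
    unfolding Rates_def
    by (intro compact_UN finite compact_Un compact_continuous_image Y slice
        C1_family_common_rate C1_family_private_rate \<sigma>)
  then obtain b where b: "\<And>r. r \<in> Rates \<Longrightarrow> \<bar>r\<bar> \<le> b"
    using compact_imp_bounded[of Rates] unfolding bounded_iff real_norm_def by blast
  have "norm (x i) \<le> 2 * b + (real CARD('k) * b + sqrt Pt)" if i: "i \<ge> 1" for i
  proof -
    let ?R = "Rt_of (x i)" and ?C = "C_of (x i)" and ?P = "P_of (x i)"
    have "?P \<bullet> ?P \<le> Pt"
      using iterate_feasible[OF i, of 0 Power] by (simp add: trace_mult_conj_transpose)
    then have P: "norm ?P \<le> sqrt Pt"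
      by (simp add: norm_eq_sqrt_inner)
    then have "(0, 0, ?P) \<in> Y" by (simp add: Y_def)
    then have "common_rate \<sigma> (P_of (0, 0, ?P)) (hhat k) \<in> Rates"
        "private_rate \<sigma> (P_of (0, 0, ?P)) k (hhat k) \<in> Rates" for k
      unfolding Rates_def by blast+
    moreover have "P_of (0, 0, ?P) = ?P" by (simp add: P_of_def)
    ultimately have rates: "common_rate \<sigma> ?P (hhat k) \<le> b"
        "private_rate \<sigma> ?P k (hhat k) \<le> b" for k
      using b by (metis abs_le_D1)+
    have C_nonneg: "?C $ k \<ge> 0" for k
      using iterate_feasible[OF i, of 0 "Nonneg k"] by simp
    fix k :: 'k
    have "(\<Sum>l\<in>UNIV. ?C $ l) \<le> b"
      using iterate_feasible[OF i, of "hhat k" "Common k"] hhat_in_samples(2)[OF i, of k]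
        rates(1)[of k] by simp
    then have C: "?C $ k \<le> b" for k
      using member_le_sum[of k UNIV "\<lambda>l. ?C $ l"] C_nonneg by simp
    have "norm ?C \<le> (\<Sum>k\<in>UNIV. \<bar>?C $ k\<bar>)"
      by (rule norm_le_l1_cart)
    also have "\<dots> \<le> real CARD('k) * b"
      using sum_bounded_above[of UNIV "\<lambda>k. \<bar>?C $ k\<bar>" b] C C_nonneg by simp
    finally have norm_C: "norm ?C \<le> real CARD('k) * b" .
    have "?R \<le> 2 * b"
      using iterate_feasible[OF i, of "hhat k" "Private k"] hhat_in_samples(1)[OF i, of k]
        rates(2)[of k] C[of k] by simp
    moreover obtain \<mu> where "sampled_multipliers \<sigma> Pt (H i) (Hc i) (x i) \<mu>"
      using sampled_kkt_point_multipliers[OF opt[OF i]] .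
    then have "?R \<ge> 0"
      using C_nonneg by (rule Rt_of_nonneg[OF \<sigma>])
    ultimately have "norm ?R \<le> 2 * b" by simp
    moreover have "norm (x i) \<le> norm ?R + (norm ?C + norm ?P)"
      using norm_Pair_le[of ?R "(?C, ?P)"] norm_Pair_le[of ?C ?P]
      by (simp add: Rt_of_def C_of_def P_of_def)
    ultimately show ?thesis using norm_C P by linarith
  qed
  then show ?thesis
    unfolding bounded_iff by auto
qed

text \<open>Sign and power constraints hold at every iterate and pass to the limit by continuity.
  The rate constraints hold at the iterates only on the samples, and these need the cuts.\<close>

lemma cluster_point_feasible:
  assumes r: "strict_mono r" "r 0 \<ge> 1" and a: "(x \<circ> r) \<longlonglongrightarrow> a"
  shows "feasible (constraint \<sigma> Pt) full_sets a"
  unfolding feasible_def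
proof (intro allI ballI)
  fix m t assume t: "t \<in> full_sets m"
  note r1 = subsequence_ge_1[OF r]
  have X: "(\<lambda>j. x (r j)) \<longlonglongrightarrow> a"
    using a by (simp add: comp_def)
  note C1 = C1_family_continuous[OF C1_family_constraint[OF \<sigma>]]
  have const: "constraint \<sigma> Pt m a t \<le> 0" if "\<And>j. constraint \<sigma> Pt m (x (r j)) t \<le> 0"
  proof (rule LIMSEQ_le_const2)
    show "(\<lambda>j. constraint \<sigma> Pt m (x (r j)) t) \<longlonglongrightarrow> constraint \<sigma> Pt m a t"
      using continuous_on_tendsto_compose[OF C1 tendsto_Pair[OF X tendsto_const]] by simp
  qed (use that in blast)
  show "constraint \<sigma> Pt m a t \<le> 0"
  proof (cases m)
    case (Private k)
    show ?thesis
      unfolding Private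
    proof (rule cutting_set_limit_feasible[OF C1 compact_index_sets[of hhat \<delta> "Private k"] X,
          where q = "\<lambda>j. h (r j) k"])
      show "constraint \<sigma> Pt (Private k) (x (r j')) (h (r j) k) \<le> 0"
        if "j < j'" "constraint \<sigma> Pt (Private k) (x (r j)) (h (r j) k) > 0" for j j'
        by (rule cuts_respected(1)[OF r1 strict_monoD[OF r(1) that(1)] that(2)])
      show "constraint \<sigma> Pt (Private k) (x (r j)) t \<le>
          constraint \<sigma> Pt (Private k) (x (r j)) (h (r j) k)"
        if "t \<in> full_sets (Private k)" for j t
        using worst_channels(3)[OF r1] that by simp
      show "h (r j) k \<in> full_sets (Private k)" for j
        using worst_channels(1)[OF r1] by simp
      show "t \<in> full_sets (Private k)"
        using t Private by simp
    qed
  next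
    case (Common k)
    show ?thesis
      unfolding Common
    proof (rule cutting_set_limit_feasible[OF C1 compact_index_sets[of hhat \<delta> "Common k"] X,
          where q = "\<lambda>j. hc (r j) k"])
      show "constraint \<sigma> Pt (Common k) (x (r j')) (hc (r j) k) \<le> 0"
        if "j < j'" "constraint \<sigma> Pt (Common k) (x (r j)) (hc (r j) k) > 0" for j j'
        by (rule cuts_respected(2)[OF r1 strict_monoD[OF r(1) that(1)] that(2)])
      show "constraint \<sigma> Pt (Common k) (x (r j)) t \<le>
          constraint \<sigma> Pt (Common k) (x (r j)) (hc (r j) k)"
        if "t \<in> full_sets (Common k)" for j t
        using worst_channels(4)[OF r1] that by simp
      show "hc (r j) k \<in> full_sets (Common k)" for j
        using worst_channels(2)[OF r1] by simp
      show "t \<in> full_sets (Common k)"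
        using t Common by simp
    qed
  next
    case (Nonneg k)
    then show ?thesis
      using t iterate_feasible[OF r1, where m = m and t = 0] by (intro const) simp
  next
    case Power
    then show ?thesis
      using t iterate_feasible[OF r1, where m = m and t = 0] by (intro const) simp
  qed
qed

lemma cluster_point_kkt:
  assumes r: "strict_mono r" "r 0 \<ge> 1" and a: "(x \<circ> r) \<longlonglongrightarrow> a"
  shows "SI_kkt_point \<sigma> Pt hhat \<delta> a"
proof -
  note r1 = subsequence_ge_1[OF r]
  obtain b where b: "\<And>i. i \<ge> 1 \<Longrightarrow> norm (x i) \<le> b"
    using iterates_bounded unfolding bounded_iff by auto
  \<comment> \<open>All iterates lie in one ball and all samples in fixed compact sets, so a single
    gradient bound \<open>B\<close>, and with it a single mass bound, serves every
    iteration.\<close>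
  define G where "G = (\<Union>m. (\<lambda>p. constraint_gradient \<sigma> Pt m (fst p) (snd p)) `
    (cball (0 :: ('n, 'k) point) b \<times> full_sets m))"
  have "compact G"
    unfolding G_def constraint_gradient_def
    by (intro compact_UN finite compact_continuous_image compact_Times compact_cball
        compact_index_sets continuous_on_subset[OF C1_family_continuous_gradient subset_UNIV]
        C1_family_constraint \<sigma>)
  then obtain B where B: "B > 0" "\<And>w. w \<in> G \<Longrightarrow> norm w \<le> B"
    using compact_imp_bounded[of G] unfolding bounded_pos by blast
  have grad: "norm (constraint_gradient \<sigma> Pt m (x i) t) \<le> B"
    if "i \<ge> 1" "t \<in> index_sets (H i) (Hc i) m" for i m t
  proof -
    have "(x i, t) \<in> cball 0 b \<times> full_sets m"
      using b[OF that(1)] index_sets_subset[OF that(1)] that(2) by auto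
    then show ?thesis
      by (intro B(2)) (force simp: G_def)
  qed
  have "\<exists>\<mu>. sampled_multipliers \<sigma> Pt (H i) (Hc i) (x i) \<mu> \<and>
      (\<Sum>m\<in>UNIV. \<Sum>t\<in>index_sets (H i) (Hc i) m. \<mu> m t) \<le> 2 + real CARD('k) + B / sqrt Pt"
    if i: "i \<ge> 1" for i
  proof -
    obtain \<mu>0 where \<mu>0: "sampled_multipliers \<sigma> Pt (H i) (Hc i) (x i) \<mu>0"
      using sampled_kkt_point_multipliers[OF opt[OF i]] .
    obtain \<mu> where \<mu>: "sampled_multipliers \<sigma> Pt (H i) (Hc i) (x i) \<mu>"
        "(\<Sum>k\<in>UNIV. \<Sum>t\<in>Hc i k. \<mu> (Common k) t) \<le> 1"
      using common_mass_normalized[OF \<sigma> \<mu>0 sampled_kkt_pointD(2)[OF opt[OF i]]] .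
    have "(\<Sum>m\<in>UNIV. \<Sum>t\<in>index_sets (H i) (Hc i) m. \<mu> m t) \<le> 2 + real CARD('k) + B / sqrt Pt"
      using multiplier_mass_bound[OF \<sigma> \<mu>(1) Pt \<mu>(2) less_imp_le[OF B(1)] grad[OF i]] .
    with \<mu>(1) show ?thesis by blast
  qed
  then obtain \<mu> where \<mu>: "\<And>i. i \<ge> 1 \<Longrightarrow> sampled_multipliers \<sigma> Pt (H i) (Hc i) (x i) (\<mu> i)"
    and mass: "\<And>i. i \<ge> 1 \<Longrightarrow>
      (\<Sum>m\<in>UNIV. \<Sum>t\<in>index_sets (H i) (Hc i) m. \<mu> i m t) \<le> 2 + real CARD('k) + B / sqrt Pt"
    by metis
  show ?thesis
    unfolding SI_kkt_point_def
  proof (rule kkt_point_limit[where X = "x \<circ> r" and \<mu> = "\<lambda>j. \<mu> (r j)"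
        and S = "\<lambda>j. index_sets (H (r j)) (Hc (r j))"])
    fix j
    note \<mu>_j = \<mu>[OF r1[of j]]
    show "(- 1, 0, 0) + (\<Sum>m\<in>UNIV. \<Sum>t\<in>index_sets (H (r j)) (Hc (r j)) m.
        \<mu> (r j) m t *\<^sub>R gradient (\<lambda>z. constraint \<sigma> Pt m z t) ((x \<circ> r) j)) = 0"
      using \<mu>_j by (simp add: sampled_multipliers_def gradient_objective constraint_gradient_def)
    show "(\<Sum>m\<in>UNIV. \<Sum>t\<in>index_sets (H (r j)) (Hc (r j)) m.
        \<mu> (r j) m t * constraint \<sigma> Pt m ((x \<circ> r) j) t) = 0"
      using multiplier_eq_0[OF \<sigma> \<mu>_j] by (intro sum.neutral ballI) simp
    show "\<mu> (r j) m t \<ge> 0" if "t \<in> index_sets (H (r j)) (Hc (r j)) m" for m t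
      by (rule multiplier_nonneg[OF \<sigma> \<mu>_j that])
    show "finite (index_sets (H (r j)) (Hc (r j)) m)" for m
      by (rule sampled_kkt_pointD(1)[OF opt[OF r1]])
    show "index_sets (H (r j)) (Hc (r j)) m \<subseteq> full_sets m" for m
      by (rule index_sets_subset[OF r1])
  qed (use gradient_objective C1_family_constraint[OF \<sigma>] compact_index_sets mass[OF r1] a
      cluster_point_feasible[OF r a] in auto)
qed

text \<open>The initial subsequence is arbitrary so that it can consist of indices staying away from
  the KKT set, which yields the contradiction; with \<open>Suc\<close> it shows that this set is
  nonempty.\<close>

lemma convergent_subsequence:
  fixes r :: "nat \<Rightarrow> nat"
  assumes "strict_mono r" "r 0 \<ge> 1"
  obtains s a where "strict_mono s" "(x \<circ> (r \<circ> s)) \<longlonglongrightarrow> a" "SI_kkt_point \<sigma> Pt hhat \<delta> a"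
proof -
  have "range (x \<circ> r) \<subseteq> x ` {1..}"
    using subsequence_ge_1[OF assms] by auto
  then have "bounded (range (x \<circ> r))"
    by (rule bounded_subset[OF iterates_bounded])
  then obtain a s where s: "strict_mono s" "((x \<circ> r) \<circ> s) \<longlonglongrightarrow> a"
    using bounded_imp_convergent_subsequence[of "x \<circ> r"] by blast
  have "strict_mono (r \<circ> s)" by (rule strict_mono_o[OF assms(1) s(1)])
  moreover have "(r \<circ> s) 0 \<ge> 1"
    using subsequence_ge_1[OF assms] by simp
  ultimately have "SI_kkt_point \<sigma> Pt hhat \<delta> a"
    using s(2) by (intro cluster_point_kkt) (auto simp: comp_assoc)
  with s show ?thesis by (intro that) (auto simp: comp_assoc)
qed

lemma iterates_converge:
  "converges_to_set x {y. SI_kkt_point \<sigma> Pt hhat \<delta> y}" (is "converges_to_set x ?S")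
  unfolding converges_to_set_def
proof
  show "?S \<noteq> {}"
    using convergent_subsequence[of Suc] by (metis One_nat_def empty_Collect_eq lessI order_refl
        strict_mono_Suc_iff)
  show "(\<lambda>i. infdist (x i) ?S) \<longlonglongrightarrow> 0"
  proof (rule ccontr)
    assume "\<not> ?thesis"
    then obtain e where e: "e > 0" and freq: "\<And>N. \<exists>i\<ge>N. infdist (x i) ?S \<ge> e"
      unfolding LIMSEQ_def by (auto simp: not_less infdist_nonneg)
    have "infinite {i. infdist (x i) ?S \<ge> e}"
      using freq unfolding infinite_nat_iff_unbounded_le by blast
    then have inf: "infinite ({i. infdist (x i) ?S \<ge> e} - {0})" by simp
    define r where "r = enumerate ({i. infdist (x i) ?S \<ge> e} - {0})"
    have r: "strict_mono r" unfolding r_def by (rule strict_mono_enumerate[OF inf])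
    have r_in: "r j \<in> {i. infdist (x i) ?S \<ge> e} - {0}" for j
      unfolding r_def by (rule enumerate_in_set[OF inf])
    have "r 0 \<ge> 1" using r_in[of 0] by simp
    then obtain s a where s: "(x \<circ> (r \<circ> s)) \<longlonglongrightarrow> a" and a: "a \<in> ?S"
      using convergent_subsequence[OF r] by blast
    obtain j where "dist ((x \<circ> (r \<circ> s)) j) a < e"
      using metric_LIMSEQ_D[OF s e] by blast
    moreover have "infdist (x (r (s j))) ?S \<le> dist (x (r (s j))) a"
      by (rule infdist_le[OF a])
    ultimately show False using r_in[of "s j"] by simp
  qed
qed

end

theorem proposition1:
  fixes \<sigma> Pt :: real
    and hhat :: "'k::finite \<Rightarrow> complex^'n::finite" and \<delta> :: "'k \<Rightarrow> real"
    and H Hc :: "nat \<Rightarrow> 'k \<Rightarrow> (complex^'n) set"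
    and x :: "nat \<Rightarrow> ('n, 'k) point"
    and h hc :: "nat \<Rightarrow> 'k \<Rightarrow> complex^'n"
  assumes "CARD('k) \<le> CARD('n)" and "\<sigma>\<^sup>2 > 0" and "Pt > 0" and "\<And>k. \<delta> k \<ge> 0"
    and "cutting_set_updates \<sigma> hhat H Hc x h hc"
    and optimization: "\<And>i. i \<ge> 1 \<Longrightarrow> sampled_kkt_point \<sigma> Pt (H i) (Hc i) (x i)"
    and pessimization: "\<And>i. i \<ge> 1 \<Longrightarrow> exact_pessimization \<sigma> hhat \<delta> (x i) (h i) (hc i)"
  shows "converges_to_set x {y. SI_kkt_point \<sigma> Pt hhat \<delta> y}"
  using assms by (intro iterates_converge) auto

end
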